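(* Let $G$ be a finitely generated group that contains a non-degenerate hyperbolically embedded subgroup. Then $\xi_G\sim \pi_G\sim 2^n$.
   Context: $\mathbb N=\{1,2,\dots\}$. For a group $G$ generated by a finite set $X$, $|g|_X$ is the word length of $g\in G$ with respect to $X\cup X^{-1}$ and $B_{G,X}(n)=\{g\in G: |g|_X\le n\}$. The conjugacy growth function $\xi_G=\xi_{G,X}\colon\mathbb N\to\mathbb N$ is defined by letting $\xi_{G,X}(n)$ be the number of conjugacy classes of $G$ that meet $B_{G,X}(n)$. A conjugacy class is primitive if some (equivalently, any) element $g$ of it is not a proper power, i.e., $h^n=g$ with $h\in G$, $n\in\mathbb Z$ implies $n=\pm1$; $\pi_G(n)$ is the number of primitive conjugacy classes of $G$ that meet $B_{G,X}(n)$. For functions $f,g$ on $\mathbb N$, $f\preceq g$ means that there is $C\in\mathbb N$ with $f(n)\le g(Cn)$ for all $n\in\mathbb N$; $f\sim g$ means $f\preceq g$ and $g\preceq f$. Up to $\sim$, these functions do not depend on the choice of the finite generating set $X$. Hyperbolically embedded subgroups. Let $G$ be a group, $H\le G$, $X\subseteq G$ (here $X$ need not be finite), with $G=\langle X\cup H\rangle$. Let $\Gamma(G,X\cup H)$ be the Cayley graph of $G$ with respect to $X\cup H$, and let $\Gamma_H$ be the Cayley graph of $H$ with respect to the generating set $H$, viewed as a complete subgraph of $\Gamma(G,X\cup H)$. For $h_1,h_2\in H$ let $\widehat d(h_1,h_2)\in[0,\infty]$ be the length of a shortest path in $\Gamma(G,X\cup H)$ that connects $h_1$ to $h_2$ and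 contains no edges of $\Gamma_H$ ($\infty$ if there is no such path). The subgroup $H$ is hyperbolically embedded in $G$ with respect to $X$ if $G=\langle X\cup H\rangle$, the graph $\Gamma(G,X\cup H)$ is a (Gromov) hyperbolic metric space, and $(H,\widehat d)$ is locally finite, i.e., every ball of finite radius is finite. $H$ is hyperbolically embedded in $G$ if this holds for some $X\subseteq G$. A hyperbolically embedded subgroup $H$ of $G$ is non-degenerate if $H$ is infinite and $H\ne G$. *)

theory Defs
  imports "HOL-Algebra.Group_Action" "HOL-Algebra.Generated_Groups" "HOL-Library.Extended_Nat" Complex_Main
begin

section \<open>Word length and balls\<close>

definition word_length :: "('a, 'b) monoid_scheme \<Rightarrow> 'a set \<Rightarrow> 'a \<Rightarrow> nat" where
  "word_length G X g =
     (LEAST n. \<exists>w. length w = n \<and> set w \<subseteq> X \<union> set_inv\<^bsub>G\<^esub> X \<and> foldr (\<otimes>\<^bsub>G\<^esub>) w \<one>\<^bsub>G\<^esub> = g)"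

definition word_ball :: "('a, 'b) monoid_scheme \<Rightarrow> 'a set \<Rightarrow> nat \<Rightarrow> 'a set" where
  "word_ball G X n = {g \<in> carrier G. word_length G X g \<le> n}"


section \<open>Conjugacy growth\<close>

definition conjugacy_classes :: "('a, 'b) monoid_scheme \<Rightarrow> 'a set set" where
  "conjugacy_classes G =
     orbits G (carrier G) (\<lambda>g. \<lambda>h\<in>carrier G. g \<otimes>\<^bsub>G\<^esub> h \<otimes>\<^bsub>G\<^esub> inv\<^bsub>G\<^esub> g)"

definition not_proper_power :: "('a, 'b) monoid_scheme \<Rightarrow> 'a \<Rightarrow> bool" where
  "not_proper_power G g \<longleftrightarrow>
     (\<forall>h\<in>carrier G. \<forall>n::int. h [^]\<^bsub>G\<^esub> n = g \<longrightarrow> n = 1 \<or> n = -1)"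

definition primitive_class :: "('a, 'b) monoid_scheme \<Rightarrow> 'a set \<Rightarrow> bool" where
  "primitive_class G c \<longleftrightarrow> (\<exists>g\<in>c. not_proper_power G g)"

definition conj_growth :: "('a, 'b) monoid_scheme \<Rightarrow> 'a set \<Rightarrow> nat \<Rightarrow> nat" where
  "conj_growth G X n = card {c \<in> conjugacy_classes G. c \<inter> word_ball G X n \<noteq> {}}"

definition prim_conj_growth :: "('a, 'b) monoid_scheme \<Rightarrow> 'a set \<Rightarrow> nat \<Rightarrow> nat" where
  "prim_conj_growth G X n =
     card {c \<in> conjugacy_classes G. primitive_class G c \<and> c \<inter> word_ball G X n \<noteq> {}}"

text \<open>
  Growth functions are functions on the positive integers; their values at \<open>0\<close>
  are ignored.
\<close>

definition growth_le :: "(nat \<Rightarrow> nat) \<Rightarrow> (nat \<Rightarrow> nat) \<Rightarrow> bool" where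
  "growth_le f g \<longleftrightarrow> (\<exists>C\<ge>1. \<forall>n\<ge>1. f n \<le> g (C * n))"

definition growth_equiv :: "(nat \<Rightarrow> nat) \<Rightarrow> (nat \<Rightarrow> nat) \<Rightarrow> bool" where
  "growth_equiv f g \<longleftrightarrow> growth_le f g \<and> growth_le g f"


section \<open>Graphs and Gromov hyperbolicity\<close>

text \<open>
  An undirected graph is given by its symmetric edge relation, so that \<open>(u, v) \<in> E ^^ n\<close>
  says that there is a path of length \<open>n\<close> from \<open>u\<close> to \<open>v\<close>. The distance
  is \<open>\<infinity>\<close> (the infimum of the empty set) if there is no path.
\<close>

definition path_dist :: "('a \<times> 'a) set \<Rightarrow> 'a \<Rightarrow> 'a \<Rightarrow> enat" where
  "path_dist E u v = (INF n\<in>{n. (u, v) \<in> E ^^ n}. enat n)"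

definition gromov_product :: "('a \<Rightarrow> 'a \<Rightarrow> real) \<Rightarrow> 'a \<Rightarrow> 'a \<Rightarrow> 'a \<Rightarrow> real" where
  "gromov_product d w x y = (d x w + d y w - d x y) / 2"

definition gromov_hyperbolic :: "'a set \<Rightarrow> ('a \<Rightarrow> 'a \<Rightarrow> real) \<Rightarrow> bool" where
  "gromov_hyperbolic M d \<longleftrightarrow>
     (\<exists>\<delta>\<ge>0. \<forall>x\<in>M. \<forall>y\<in>M. \<forall>z\<in>M. \<forall>w\<in>M.
        gromov_product d w x z \<ge> min (gromov_product d w x y) (gromov_product d w y z) - \<delta>)"

text \<open>
  A connected graph is regarded as a metric space via the path metric on its vertex set.
  Passing to the geometric realization would only change the hyperbolicity constant, as the
  vertex set is \<open>1/2\<close>-dense in it.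
\<close>

definition hyperbolic_graph :: "'a set \<Rightarrow> ('a \<times> 'a) set \<Rightarrow> bool" where
  "hyperbolic_graph V E \<longleftrightarrow>
     (\<forall>u\<in>V. \<forall>v\<in>V. path_dist E u v \<noteq> \<infinity>) \<and>
     gromov_hyperbolic V (\<lambda>u v. real (the_enat (path_dist E u v)))"

definition cayley_graph :: "('a, 'b) monoid_scheme \<Rightarrow> 'a set \<Rightarrow> ('a \<times> 'a) set" where
  "cayley_graph G S = {(u, v). u \<in> carrier G \<and> v \<in> carrier G \<and>
     (\<exists>s\<in>S. v = u \<otimes>\<^bsub>G\<^esub> s \<or> u = v \<otimes>\<^bsub>G\<^esub> s)}"


section \<open>Hyperbolically embedded subgroups\<close>

text \<open>
  The generating set of the Cayley graph is the plain union \<open>X \<union> H\<close>, so elements of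
  \<open>X \<inter> H\<close> give no additional edges: every edge joining two elements of \<open>H\<close> belongs
  to the Cayley graph of \<open>H\<close> and is removed.
\<close>

definition relative_dist :: "('a, 'b) monoid_scheme \<Rightarrow> 'a set \<Rightarrow> 'a set \<Rightarrow> 'a \<Rightarrow> 'a \<Rightarrow> enat" where
  "relative_dist G H X =
     path_dist (cayley_graph G (X \<union> H) - cayley_graph (G\<lparr>carrier := H\<rparr>) H)"

definition hyp_embedded_wrt :: "('a, 'b) monoid_scheme \<Rightarrow> 'a set \<Rightarrow> 'a set \<Rightarrow> bool" where
  "hyp_embedded_wrt G H X \<longleftrightarrow>
     subgroup H G \<and> X \<subseteq> carrier G \<and>
     generate G (X \<union> H) = carrier G \<and>
     hyperbolic_graph (carrier G) (cayley_graph G (X \<union> H)) \<and>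
     (\<forall>h\<in>H. \<forall>n::nat. finite {k \<in> H. relative_dist G H X h k \<le> enat n})"

definition hyp_embedded :: "('a, 'b) monoid_scheme \<Rightarrow> 'a set \<Rightarrow> bool" where
  "hyp_embedded G H \<longleftrightarrow> (\<exists>X\<subseteq>carrier G. hyp_embedded_wrt G H X)"

definition nondegenerate_hyp_embedded :: "('a, 'b) monoid_scheme \<Rightarrow> 'a set \<Rightarrow> bool" where
  "nondegenerate_hyp_embedded G H \<longleftrightarrow> hyp_embedded G H \<and> infinite H \<and> H \<noteq> carrier G"

end

theory Submission
  imports Defs
begin

text \<open>
  Let \<open>Y\<close> range over the left cosets of \<open>H\<close> in the Cayley graph \<open>\<Gamma>\<close> with respect to \<open>X \<union> H\<close>, and compare
  points of \<open>Y\<close> by the path metric of \<open>\<Gamma>\<close> with the edges of \<open>Y\<close> removed. By hyperbolicity a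
  geodesic without an edge in \<open>Y\<close> has a uniformly bounded nearest-point projection to \<open>Y\<close>, and
  Behrstock's inequality for pairs of cosets follows. Fix \<open>a \<in> X - H\<close> and far apart \<open>b\<^sub>0, b\<^sub>1, b\<^sub>2 \<in> H\<close>.
  Behrstock's inequality shows that the cosets traversed by the periodic bi-infinite path with
  label \<open>\<dots> h\<^sub>1 a h\<^sub>2 a \<dots>\<close> (\<open>h\<^sub>i \<in> {b\<^sub>0, b\<^sub>1, b\<^sub>2}\<close>) are linearly ordered by their projections, so that two
  such paths which stay at bounded distance traverse the same cosets, entering and leaving each of
  them at nearby points. As the letters are far apart, the labels agree up to a shift.
  For the elements \<open>b\<^sub>0 a h\<^sub>1 a \<dots> h\<^sub>n a\<close> with \<open>h\<^sub>i \<in> {b\<^sub>1, b\<^sub>2}\<close> the marker \<open>b\<^sub>0\<close> determines the shift, so these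
  \<open>2\<^sup>n\<close> elements are pairwise not conjugate. If \<open>g = t\<^sup>m\<close> is one of them, then \<open>t\<close> commutes with \<open>g\<close>, hence
  shifts the cosets by \<open>k\<close> periods, and \<open>m k = 1\<close>.
\<close>

section \<open>Projections to cliques in hyperbolic graphs\<close>

lemma relpow_sym: "sym R \<Longrightarrow> sym (R ^^ n)" for R :: "('a \<times> 'a) set"
proof (induction n)
  case (Suc n)
  then show ?case
    unfolding sym_def by (metis relpow_Suc_E relpow_Suc_I2)
qed (auto simp: sym_def)

text \<open>Surjectivity leaves no integer out between \<open>\<sigma> i\<close> and
  \<open>\<sigma> (i + 1)\<close>, so every step is exactly 1.\<close>

lemma strict_mono_surj_int_shift:
  fixes \<sigma> :: "int \<Rightarrow> int"
  assumes "strict_mono \<sigma>" "surj \<sigma>"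
  shows "\<sigma> i = i + \<sigma> 0"
proof -
  have step: "\<sigma> (i + 1) = \<sigma> i + 1" for i
  proof -
    obtain k where k: "\<sigma> k = \<sigma> i + 1" using assms(2) by (metis surjD)
    have "\<sigma> i < \<sigma> k" using k by simp
    then have "i + 1 \<le> k" using strict_mono_less[OF assms(1)] by force
    then have "\<sigma> (i + 1) \<le> \<sigma> k" using strict_mono_less_eq[OF assms(1)] by blast
    moreover have "\<sigma> i < \<sigma> (i + 1)" using strict_mono_less[OF assms(1)] by simp
    ultimately show ?thesis using k by linarith
  qed
  show ?thesis
  proof (induction i rule: int_induct[where k = 0])
    case (step2 i)
    then show ?case using step[of "i - 1"] by simp
  qed (use step in auto)
qed

text \<open>An abstract Cayley graph with respect to \<open>X \<union> H\<close>: the elements of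
  \<open>H\<close> are generators, so the left cosets of \<open>H\<close> are disjoint complete
  subgraphs, with loops. \<open>dist_walk\<close> and \<open>dist_le\<close> characterise
  \<open>d\<close> as the graph distance; \<open>four_point\<close> is Gromov's condition in
  integers.\<close>

locale hyperbolic_cliques =
  fixes V :: "'a set" and E :: "('a \<times> 'a) set" and cliques :: "'a set set"
    and d :: "'a \<Rightarrow> 'a \<Rightarrow> nat" and \<Delta> :: nat
  assumes E_subset: "E \<subseteq> V \<times> V"
    and E_sym: "sym E"
    and dist_walk: "\<lbrakk>x \<in> V; y \<in> V\<rbrakk> \<Longrightarrow> (x, y) \<in> E ^^ d x y"
    and dist_le: "(x, y) \<in> E ^^ n \<Longrightarrow> d x y \<le> n"
    and four_point: "\<lbrakk>x \<in> V; y \<in> V; z \<in> V; w \<in> V\<rbrakk> \<Longrightarrow>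
      d x z + d y w \<le> max (d x y + d z w) (d y z + d x w) + \<Delta>"
    and clique_subset: "Y \<in> cliques \<Longrightarrow> Y \<subseteq> V"
    and clique_nonempty: "Y \<in> cliques \<Longrightarrow> Y \<noteq> {}"
    and clique_edge: "\<lbrakk>Y \<in> cliques; y \<in> Y; y' \<in> Y\<rbrakk> \<Longrightarrow> (y, y') \<in> E"
    and clique_disjoint: "\<lbrakk>Y \<in> cliques; Z \<in> cliques; Y \<noteq> Z\<rbrakk> \<Longrightarrow> Y \<inter> Z = {}"
begin

text \<open>For \<open>Y = H\<close> and points of \<open>H\<close> this bounds the relative
  distance by \<open>n\<close>. A relation with a bound keeps the value infinity out of all later
  estimates.\<close>

definition near :: "'a set \<Rightarrow> nat \<Rightarrow> 'a \<Rightarrow> 'a \<Rightarrow> bool" where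
  "near Y n u v \<longleftrightarrow> (\<exists>m\<le>n. (u, v) \<in> (E - Y \<times> Y) ^^ m)"

definition nearest :: "'a set \<Rightarrow> 'a \<Rightarrow> 'a \<Rightarrow> bool" where
  "nearest Y x y \<longleftrightarrow> y \<in> Y \<and> (\<forall>z\<in>Y. d x y \<le> d x z)"

lemma walk_in_V:
  assumes "(x, y) \<in> E ^^ n" "x \<in> V"
  shows "y \<in> V"
  using assms E_subset by (cases n) auto

lemma dist_sym: "\<lbrakk>x \<in> V; y \<in> V\<rbrakk> \<Longrightarrow> d x y = d y x"
  by (meson E_sym dist_le dist_walk le_antisym relpow_sym symD)

lemma dist_triangle: "\<lbrakk>x \<in> V; y \<in> V; z \<in> V\<rbrakk> \<Longrightarrow> d x z \<le> d x y + d y z"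
  by (meson dist_le dist_walk relpow_trans)

lemma dist_refl: "d x x = 0"
  using dist_le[of x x 0] by simp

lemma near_refl [simp]: "near Y n u u"
  unfolding near_def by (intro exI[of _ 0]) auto

lemma near_sym: "near Y n u v \<Longrightarrow> near Y n v u"
proof -
  assume "near Y n u v"
  moreover have "sym (E - Y \<times> Y)"
    using E_sym by (auto simp: sym_def)
  ultimately show ?thesis
    unfolding near_def by (meson relpow_sym symD)
qed

lemma near_trans: "\<lbrakk>near Y m u v; near Y n v w\<rbrakk> \<Longrightarrow> near Y (m + n) u w"
  unfolding near_def by (meson add_mono relpow_trans)

lemma near_mono: "\<lbrakk>near Y m u v; m \<le> n\<rbrakk> \<Longrightarrow> near Y n u v"
  unfolding near_def by (meson le_trans)

lemma near_subpath:
  assumes "\<forall>i<n. (\<gamma> i, \<gamma> (Suc i)) \<in> E - Y \<times> Y" "i \<le> j" "j \<le> n"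
  shows "near Y (j - i) (\<gamma> i) (\<gamma> j)"
proof -
  have "(\<gamma> i, \<gamma> j) \<in> (E - Y \<times> Y) ^^ (j - i)"
    unfolding relpow_fun_conv using assms by (intro exI[of _ "\<lambda>k. \<gamma> (i + k)"]) auto
  then show ?thesis by (auto simp: near_def)
qed

text \<open>Vertex \<open>i\<close> of the walk is at distance at most \<open>i < m\<close> from
  \<open>u\<close>, hence outside \<open>Y\<close>. Only the last vertex can lie in
  \<open>Y\<close>, so no edge is inside.\<close>

lemma near_if_far_from:
  assumes "(u, v) \<in> E ^^ m" "\<forall>z\<in>Y. m \<le> d u z" "m > 0 \<longrightarrow> u \<notin> Y"
  shows "near Y m u v"
proof -
  obtain f where f: "f 0 = u" "f m = v" "\<forall>i<m. (f i, f (Suc i)) \<in> E"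
    using assms(1) unfolding relpow_fun_conv by auto
  have "f i \<notin> Y" if "i < m" for i
  proof
    assume "f i \<in> Y"
    moreover have "(u, f i) \<in> E ^^ i"
      unfolding relpow_fun_conv using f that by (intro exI[of _ f]) auto
    ultimately show False
      using assms(2) dist_le[of u "f i" i] that by fastforce
  qed
  with f show ?thesis
    using near_subpath[of m f Y 0 m] by auto
qed

lemma near_nearest:
  assumes "u \<in> V" "Y \<subseteq> V" "nearest Y u y"
  shows "near Y (d u y) u y"
proof (rule near_if_far_from)
  show "(u, y) \<in> E ^^ d u y"
    using assms dist_walk by (auto simp: nearest_def)
  show "\<forall>z\<in>Y. d u y \<le> d u z"
    using assms by (auto simp: nearest_def)
  show "0 < d u y \<longrightarrow> u \<notin> Y"
    using assms dist_refl by (metis nearest_def not_less)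
qed

text \<open>Cut a geodesic from \<open>x\<close> to \<open>y\<close> at distance \<open>k\<close>
  before its end. A point of \<open>Y\<close> closer than \<open>y\<close> to the cut point would
  also be closer to \<open>x\<close>.\<close>

lemma descend:
  assumes "x \<in> V" "Y \<subseteq> V" "nearest Y x y" "k \<le> d x y"
  obtains u where "u \<in> V" "d x u = d x y - k" "d u y = k" "nearest Y u y"
proof -
  have y: "y \<in> V" using assms by (auto simp: nearest_def)
  have "(x, y) \<in> E ^^ ((d x y - k) + k)"
    using dist_walk assms y by simp
  then obtain u where u: "(x, u) \<in> E ^^ (d x y - k)" "(u, y) \<in> E ^^ k"
    unfolding relpow_add by blast
  have uV: "u \<in> V" using u(1) assms(1) walk_in_V by blast
  have "d x u = d x y - k" "d u y = k"
    using dist_le[OF u(1)] dist_le[OF u(2)] dist_triangle[OF assms(1) uV y] assms(4) by linarith+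
  moreover have "d u y \<le> d u z" if "z \<in> Y" for z
  proof -
    have "d x y \<le> d x z" "d x z \<le> d x u + d u z"
      using that assms dist_triangle uV by (auto simp: nearest_def)
    with calculation assms(4) show ?thesis by linarith
  qed
  ultimately show thesis
    using that uV assms(3) by (auto simp: nearest_def)
qed

lemma subgeodesic:
  assumes "\<gamma> 0 = x" "\<gamma> (d x x') = x'" "\<forall>i<d x x'. (\<gamma> i, \<gamma> (Suc i)) \<in> E"
    and "x \<in> V" "x' \<in> V" "i \<le> d x x'"
  shows "\<gamma> i \<in> V" "d x (\<gamma> i) = i" "d (\<gamma> i) x' = d x x' - i"
proof -
  have 1: "(x, \<gamma> i) \<in> E ^^ i"
    unfolding relpow_fun_conv using assms by (intro exI[of _ \<gamma>]) auto
  have 2: "(\<gamma> i, x') \<in> E ^^ (d x x' - i)"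
    unfolding relpow_fun_conv using assms by (intro exI[of _ "\<lambda>k. \<gamma> (i + k)"]) auto
  show V: "\<gamma> i \<in> V" using 1 assms walk_in_V by blast
  show "d x (\<gamma> i) = i" "d (\<gamma> i) x' = d x x' - i"
    using dist_le[OF 1] dist_le[OF 2] dist_triangle[OF assms(4) V assms(5)] assms(6) by linarith+
qed

text \<open>Let \<open>u\<close> lie on a geodesic from \<open>x\<close> to \<open>y\<close> at
  distance \<open>r\<close> from \<open>y\<close>, and let \<open>v\<close> lie on
  \<open>\<gamma>\<close> as far from \<open>x\<close> as \<open>u\<close>. Two uses of
  \<open>four_point\<close> give \<open>d u v \<le> 2 * \<Delta> < r\<close>, so a geodesic from
  \<open>u\<close> to \<open>v\<close> does not reach \<open>Y\<close>.\<close>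

lemma near_geodesic_if_long:
  assumes \<gamma>: "\<gamma> 0 = x" "\<gamma> (d x x') = x'" "\<forall>i<d x x'. (\<gamma> i, \<gamma> (Suc i)) \<in> E"
    and V: "x \<in> V" "x' \<in> V" "Y \<subseteq> V" and cl: "\<And>y y'. \<lbrakk>y \<in> Y; y' \<in> Y\<rbrakk> \<Longrightarrow> d y y' \<le> 1"
    and y: "nearest Y x y" and y': "nearest Y x' y'"
    and long: "d x y + d x' y' + 1 \<le> d x x' + 2 * r" and r: "r = 2 * \<Delta> + 2"
  shows "near Y (r + 2 * \<Delta>) y (\<gamma> (d x y - r))" "d x y - r \<le> d x x'"
proof -
  have yV: "y \<in> V" "y' \<in> V" using y y' V by (auto simp: nearest_def)
  have yy': "d y y' \<le> 1" using cl y y' by (auto simp: nearest_def)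
  have yx': "d y x' \<le> d x' y' + 1"
    using dist_triangle[OF yV V(2)] dist_sym[of x' y'] V yV yy' by simp
  have ab: "d x y \<le> d x x' + d y x'"
    using dist_triangle[OF V(1) V(2) yV(1)] dist_sym[of x' y] V yV by simp
  show le: "d x y - r \<le> d x x'" using ab yx' long by linarith
  show "near Y (r + 2 * \<Delta>) y (\<gamma> (d x y - r))"
  proof (cases "d x y < r")
    \<comment> \<open>Truncated subtraction turns \<open>\<gamma> (d x y - r)\<close> into
      \<open>x\<close>, and the projection geodesic of \<open>x\<close> is itself short
      enough.\<close>
    case True
    then show ?thesis
      using near_mono[OF near_sym[OF near_nearest[OF V(1,3) y]], of "r + 2 * \<Delta>"] \<gamma> by simp
  next
    case False
    then obtain u where u: "u \<in> V" "d x u = d x y - r" "d u y = r" "nearest Y u y"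
      using descend[OF V(1,3) y, of r] by auto
    define v where "v = \<gamma> (d x y - r)"
    have v: "v \<in> V" "d x v = d x y - r" "d v x' = d x x' - (d x y - r)"
      unfolding v_def using subgeodesic[OF \<gamma> V(1,2) le] by auto
    have "d x y + d u x' \<le> max (d x u + d y x') (d u y + d x x') + \<Delta>"
      using four_point[of x u y x'] u yV V by simp
    then have ux': "d u x' \<le> d x x' - (d x y - r) + \<Delta>"
      using u yx' long False le by linarith
    have "d x x' + d u v \<le> max (d x u + d x' v) (d u x' + d x v) + \<Delta>"
      using four_point[of x u x' v] u v V by simp
    then have uv: "d u v \<le> 2 * \<Delta>"
      using u(2) v(2,3) ux' le dist_sym[OF V(2) v(1)] by linarith
    have "r \<le> d u z" if "z \<in> Y" for z
      using that u by (auto simp: nearest_def)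
    moreover have "u \<notin> Y"
      using calculation[of u] dist_refl r by force
    ultimately have "near Y (d u v) u v"
      using near_if_far_from[OF dist_walk[OF u(1) v(1)], of Y] uv r by fastforce
    then have "near Y (r + 2 * \<Delta>) y v"
      using near_trans[OF near_sym[OF near_nearest[OF u(1) V(3) u(4)]], of "d u v" v] near_mono uv u(3)
      by auto
    then show ?thesis by (simp add: v_def)
  qed
qed

text \<open>
  With \<open>r = 2 * \<Delta> + 2\<close>, the length of a path that follows the two projection geodesics up to
  distance \<open>r\<close> from \<open>Y\<close>, jumps to \<open>\<gamma>\<close> (\<open>2 * \<Delta>\<close> twice) and follows \<open>\<gamma>\<close> for at most \<open>2 * r + 1\<close> steps.
\<close>

definition K :: nat where "K = 12 * \<Delta> + 9"

text \<open>If \<open>\<gamma>\<close> is long compared with the distances to \<open>Y\<close>,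
  \<open>near_geodesic_if_long\<close> joins \<open>y\<close> and \<open>y'\<close> to
  \<open>\<gamma>\<close>, and the stretch of \<open>\<gamma>\<close> in between has no edge in
  \<open>Y\<close>. Otherwise the points at distance \<open>r\<close> from \<open>Y\<close> on the
  two projection geodesics are within \<open>2 * \<Delta> + 1 < r\<close> of each other, so joining
  them directly avoids \<open>Y\<close>.\<close>

lemma projection_of_geodesic:
  assumes \<gamma>: "\<gamma> 0 = x" "\<gamma> (d x x') = x'" "\<forall>i<d x x'. (\<gamma> i, \<gamma> (Suc i)) \<in> E - Y \<times> Y"
    and V: "x \<in> V" "x' \<in> V" "Y \<in> cliques"
    and y: "nearest Y x y" and y': "nearest Y x' y'"
  shows "near Y K y y'"
proof -
  define r where "r = 2 * \<Delta> + 2"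
  have YV: "Y \<subseteq> V" using clique_subset V by blast
  have cl: "d y y' \<le> 1" if "y \<in> Y" "y' \<in> Y" for y y'
    using clique_edge[OF V(3) that] dist_le[of y y' 1] by simp
  have yV: "y \<in> V" "y' \<in> V" using y y' YV by (auto simp: nearest_def)
  have yy': "d y y' \<le> 1" using cl y y' by (auto simp: nearest_def)
  have xx': "d x x' = d x' x" using dist_sym V by blast
  have yx': "d y x' \<le> d x' y' + 1"
    using dist_triangle[OF yV V(2)] dist_sym[of x' y'] V yV yy' by simp
  show ?thesis
  proof (cases "d x y + d x' y' + 1 \<le> d x x' + 2 * r")
    case True
    \<comment> \<open>The other end is treated by reversing \<open>\<gamma>\<close>.\<close>
    define \<gamma>' where "\<gamma>' i = \<gamma> (d x x' - i)" for i
    have 1: "near Y (r + 2 * \<Delta>) y (\<gamma> (d x y - r))" "d x y - r \<le> d x x'"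
      using near_geodesic_if_long[OF \<gamma>(1,2) _ V(1,2) YV cl y y' True r_def] \<gamma> by auto
    have "(\<gamma>' i, \<gamma>' (Suc i)) \<in> E" if "i < d x x'" for i
    proof -
      have "(\<gamma> (d x x' - Suc i), \<gamma> (Suc (d x x' - Suc i))) \<in> E"
        using \<gamma>(3) that by auto
      moreover have "Suc (d x x' - Suc i) = d x x' - i" using that by simp
      ultimately show ?thesis using E_sym unfolding \<gamma>'_def by (auto dest: symD)
    qed
    then have \<gamma>'E: "\<forall>i<d x' x. (\<gamma>' i, \<gamma>' (Suc i)) \<in> E" using xx' by simp
    have \<gamma>'0: "\<gamma>' 0 = x'" "\<gamma>' (d x' x) = x" using \<gamma> xx' by (auto simp: \<gamma>'_def)
    have 2: "near Y (r + 2 * \<Delta>) y' (\<gamma>' (d x' y' - r))" "d x' y' - r \<le> d x' x"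
      using near_geodesic_if_long[OF \<gamma>'0 \<gamma>'E V(2,1) YV cl y' y _ r_def] True xx' by auto
    have xx'_le: "d x x' \<le> d x y + d x' y' + 1"
      using dist_triangle[OF V(1) yV(1) V(2)] yx' by linarith
    have xy_le: "d x y \<le> d x x' + d x' y' + 1"
      using dist_triangle[OF V(1) V(2) yV(1)] dist_sym[of x' y] yx' V yV by simp
    \<comment> \<open>The point of \<open>\<gamma>\<close> reached from \<open>y\<close> comes no
      later than the one reached from \<open>y'\<close>, so \<open>near_subpath\<close> applies to
      the stretch between them.\<close>
    have ord: "d x y - r \<le> d x x' - (d x' y' - r)"
      using True 1(2) 2(2) xx' xy_le by linarith
    have "near Y (d x x' - (d x' y' - r) - (d x y - r)) (\<gamma> (d x y - r)) (\<gamma>' (d x' y' - r))"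
      unfolding \<gamma>'_def by (rule near_subpath[OF \<gamma>(3) ord]) simp
    from near_trans[OF near_trans[OF 1(1) this] near_sym[OF 2(1)]]
    show ?thesis
    proof (rule near_mono)
      show "r + 2 * \<Delta> + (d x x' - (d x' y' - r) - (d x y - r)) + (r + 2 * \<Delta>) \<le> K"
        using xx'_le unfolding K_def r_def by linarith
    qed
  next
    case False
    have a: "r \<le> d x y"
      using False dist_triangle[OF V(2) V(1) yV(2)] dist_triangle[OF V(1) yV] xx' yy' by linarith
    have b: "r \<le> d x' y'"
      using False dist_triangle[OF V(1) V(2) yV(1)] yx' dist_sym[of x' y] V yV by simp
    obtain u where u: "u \<in> V" "d x u = d x y - r" "d u y = r" "nearest Y u y"
      using descend[OF V(1) YV y a] by auto
    obtain u' where u': "u' \<in> V" "d x' u' = d x' y' - r" "d u' y' = r" "nearest Y u' y'"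
      using descend[OF V(2) YV y' b] by auto
    have "d x y + d u x' \<le> max (d x u + d y x') (d u y + d x x') + \<Delta>"
      using four_point[of x u y x'] u yV V by simp
    then have ux': "d u x' \<le> d x' y' + 1 - r + \<Delta>"
      using u yx' False a b by linarith
    have uy': "d u y' \<le> r + 1" using dist_triangle[OF u(1) yV] u yy' by linarith
    have "d x' y' + d u u' \<le> max (d x' u + d y' u') (d u y' + d x' u') + \<Delta>"
      using four_point[of x' u y' u'] u u' yV V by simp
    then have uu': "d u u' \<le> 2 * \<Delta> + 1"
      using u u' ux' uy' b dist_sym[of x' u] dist_sym[of y' u'] yV V by auto
    have "r \<le> d u z" if "z \<in> Y" for z
      using that u by (auto simp: nearest_def)
    moreover have "u \<notin> Y"
      using calculation[of u] dist_refl r_def by force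
    ultimately have "near Y (d u u') u u'"
      using near_if_far_from[OF dist_walk[OF u(1) u'(1)], of Y] uu' r_def by fastforce
    from near_trans[OF near_trans[OF near_sym[OF near_nearest[OF u(1) YV u(4)]] this]
        near_nearest[OF u'(1) YV u'(4)]]
    show ?thesis
      by (rule near_mono) (use u u' uu' r_def in \<open>simp add: K_def\<close>)
  qed
qed

section \<open>Nearest-point projections and Behrstock's inequality\<close>

definition proj :: "'a set \<Rightarrow> 'a \<Rightarrow> 'a" where
  "proj Y x = (SOME y. nearest Y x y)"

lemma nearest_proj:
  assumes "Y \<in> cliques"
  shows "nearest Y x (proj Y x)"
proof -
  obtain y where "y \<in> Y" using clique_nonempty assms by blast
  then have "\<exists>y. nearest Y x y"
    using arg_min_nat_lemma[of "\<lambda>y. y \<in> Y" y "d x"] unfolding nearest_def by blast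
  then show ?thesis unfolding proj_def by (rule someI_ex)
qed

lemma proj_self:
  assumes "Y \<in> cliques" "y \<in> Y"
  shows "proj Y y = y"
proof -
  have "y \<in> V" "proj Y y \<in> V"
    using nearest_proj[OF assms(1), of y] assms clique_subset by (auto simp: nearest_def)
  moreover have "d y (proj Y y) = 0"
    using nearest_proj[OF assms(1), of y] assms dist_refl by (metis le_zero_eq nearest_def)
  ultimately show ?thesis using dist_walk[of y "proj Y y"] by simp
qed

text \<open>In the usual notation for projections this is \<open>d_Y(x, x') \<le> n\<close>, with
  \<open>near Y\<close> in the role of the metric on \<open>Y\<close>.\<close>

definition prox :: "'a set \<Rightarrow> nat \<Rightarrow> 'a \<Rightarrow> 'a \<Rightarrow> bool" where
  "prox Y n x x' \<longleftrightarrow> near Y n (proj Y x) (proj Y x')"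

lemma prox_refl [simp]: "prox Y n x x"
  by (simp add: prox_def)

lemma prox_sym: "prox Y n x y \<Longrightarrow> prox Y n y x"
  unfolding prox_def by (rule near_sym)

lemma prox_trans: "\<lbrakk>prox Y m x y; prox Y n y z\<rbrakk> \<Longrightarrow> prox Y (m + n) x z"
  unfolding prox_def by (rule near_trans)

lemma prox_mono: "\<lbrakk>prox Y m x y; m \<le> n\<rbrakk> \<Longrightarrow> prox Y n x y"
  unfolding prox_def by (rule near_mono)

lemma prox_near: "\<lbrakk>Y \<in> cliques; x \<in> Y; y \<in> Y\<rbrakk> \<Longrightarrow> prox Y n x y \<longleftrightarrow> near Y n x y"
  by (simp add: prox_def proj_self)

lemma geodesic_edge_if_not_prox:
  assumes "\<gamma> 0 = x" "\<gamma> (d x x') = x'" "\<forall>i<d x x'. (\<gamma> i, \<gamma> (Suc i)) \<in> E"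
    and "x \<in> V" "x' \<in> V" "Y \<in> cliques" "\<not> prox Y K x x'"
  obtains i where "i < d x x'" "\<gamma> i \<in> Y" "\<gamma> (Suc i) \<in> Y"
  using projection_of_geodesic[OF assms(1,2) _ assms(4-6) nearest_proj[OF assms(6)] nearest_proj[OF assms(6)]]
    assms(3,7) unfolding prox_def by blast

text \<open>An edge with distinct ends is a geodesic of length 1, so this is a case of
  \<open>projection_of_geodesic\<close>.\<close>

lemma prox_edge:
  assumes "(x, x') \<in> E" "Y \<in> cliques" "\<not> (x \<in> Y \<and> x' \<in> Y)"
  shows "prox Y K x x'"
proof (cases "x = x'")
  case False
  have V: "x \<in> V" "x' \<in> V" using assms E_subset by auto
  have "d x x' \<le> 1" using assms dist_le[of x x' 1] by simp
  moreover have "d x x' \<noteq> 0" using dist_walk[OF V] False by (cases "d x x' = 0") auto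
  ultimately have dx: "d x x' = 1" by linarith
  show ?thesis
  proof (rule ccontr)
    assume "\<not> prox Y K x x'"
    then show False
      using geodesic_edge_if_not_prox[of "\<lambda>i. if i = 0 then x else x'" x x' Y] assms V dx by auto
  qed
qed auto

text \<open>Two points of \<open>Z\<close> are joined by an edge, which cannot lie in the disjoint
  clique \<open>Y\<close>.\<close>

lemma prox_clique:
  assumes "Y \<in> cliques" "Z \<in> cliques" "Y \<noteq> Z" "x \<in> Z" "x' \<in> Z"
  shows "prox Y K x x'"
  using prox_edge[OF clique_edge[OF assms(2,4,5)] assms(1)] clique_disjoint[OF assms(1-3)] assms(4)
  by blast

text \<open>If \<open>x\<close> and \<open>z\<close> have far projections to \<open>Y\<close>, a
  geodesic from \<open>x\<close> to its nearest point \<open>z0\<close> in \<open>Z\<close> passes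
  through some \<open>y1\<close> in \<open>Y\<close>. As \<open>z0\<close> is also nearest to
  \<open>y1\<close>, the projections of \<open>x\<close> and \<open>y1\<close> to \<open>Z\<close>
  are close, and \<open>prox_clique\<close> passes from \<open>y1\<close> to
  \<open>y\<close>.\<close>

lemma behrstock:
  assumes "Y \<in> cliques" "Z \<in> cliques" "Y \<noteq> Z" "x \<in> V" "y \<in> Y" "z \<in> Z"
  shows "prox Y (2 * K) x z \<or> prox Z (2 * K) x y"
proof (rule disjCI)
  assume *: "\<not> prox Z (2 * K) x y"
  show "prox Y (2 * K) x z"
  proof (rule ccontr)
    assume neg: "\<not> prox Y (2 * K) x z"
    define z0 where "z0 = proj Z x"
    have z0: "nearest Z x z0" unfolding z0_def by (rule nearest_proj[OF assms(2)])
    then have z0Z: "z0 \<in> Z" by (simp add: nearest_def)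
    then have z0V: "z0 \<in> V" using clique_subset assms by blast
    have "prox Y K z0 z" using prox_clique assms z0Z by blast
    with neg have "\<not> prox Y K x z0"
      using prox_trans[of Y K x z0 K z] by (auto simp: mult_2)
    moreover obtain \<gamma> where \<gamma>: "\<gamma> 0 = x" "\<gamma> (d x z0) = z0" "\<forall>i<d x z0. (\<gamma> i, \<gamma> (Suc i)) \<in> E"
      using dist_walk[OF assms(4) z0V] unfolding relpow_fun_conv by blast
    ultimately obtain i where i: "i < d x z0" "\<gamma> i \<in> Y"
      using geodesic_edge_if_not_prox assms z0V by metis
    define y1 where "y1 = \<gamma> i"
    have y1: "y1 \<in> V" "d x y1 = i" "d y1 z0 = d x z0 - i"
      unfolding y1_def using subgeodesic[OF \<gamma> assms(4) z0V] i by auto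
    have "d y1 z0 \<le> d y1 w" if "w \<in> Z" for w
    proof -
      have "w \<in> V" using that clique_subset assms by blast
      then have "d x z0 \<le> d x y1 + d y1 w"
        using dist_triangle[OF assms(4) y1(1)] z0 that unfolding nearest_def by (meson le_trans)
      with y1 show ?thesis by linarith
    qed
    then have "nearest Z y1 z0" using z0Z by (simp add: nearest_def)
    \<comment> \<open>Here the geodesic is constant: two nearest points of the same vertex are
      within \<open>K\<close>, whichever one \<open>proj\<close> chooses.\<close>
    then have "near Z K z0 (proj Z y1)"
      using projection_of_geodesic[of "\<lambda>_. y1" y1 y1 Z z0 "proj Z y1"] y1 assms nearest_proj[OF assms(2)]
        dist_refl by auto
    then have "prox Z K x y1" by (simp add: prox_def z0_def)
    moreover have "prox Z K y1 y"
      using prox_clique[of Z Y y1 y] assms i by (auto simp: y1_def)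
    ultimately show False using prox_trans[of Z K x y1 K y] * by (simp add: mult_2)
  qed
qed


section \<open>Chains of cliques\<close>

lemma prox_trans_le: "\<lbrakk>prox Y m x y; prox Y n y z; m + n \<le> k\<rbrakk> \<Longrightarrow> prox Y k x z"
  using prox_trans prox_mono by blast

text \<open>
  The bound \<open>15 * K\<close> is what \<open>asymptotic_clique\<close> needs: \<open>7 * K\<close> from a chain that avoids \<open>Y i\<close> and
  \<open>4 * K\<close> at each of its two ends.
\<close>

definition chain :: "(int \<Rightarrow> 'a set) \<Rightarrow> (int \<Rightarrow> 'a) \<Rightarrow> (int \<Rightarrow> 'a) \<Rightarrow> bool" where
  "chain Y p q \<longleftrightarrow> (\<forall>i. Y i \<in> cliques \<and> p i \<in> Y i \<and> q i \<in> Y i \<and> (q i, p (i + 1)) \<in> E \<and>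
     Y i \<noteq> Y (i + 1) \<and> \<not> near (Y i) (15 * K) (p i) (q i))"

lemma chainD:
  assumes "chain Y p q"
  shows "Y i \<in> cliques" "p i \<in> Y i" "q i \<in> Y i" "p i \<in> V" "q i \<in> V" "(q i, p (i + 1)) \<in> E"
    "Y i \<noteq> Y (i + 1)" "n \<le> 15 * K \<Longrightarrow> \<not> prox (Y i) n (p i) (q i)"
proof -
  show *: "Y i \<in> cliques" "p i \<in> Y i" "q i \<in> Y i" "(q i, p (i + 1)) \<in> E" "Y i \<noteq> Y (i + 1)"
    using assms unfolding chain_def by blast+
  then show "p i \<in> V" "q i \<in> V" using clique_subset by blast+
  show "\<not> prox (Y i) n (p i) (q i)" if "n \<le> 15 * K"
    using assms * that near_mono unfolding chain_def by (metis prox_near)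
qed

lemma chain_exit_proj:
  assumes "chain Y p q"
  shows "prox (Y i) K (q i) (p (i + 1))" "prox (Y (i + 1)) K (q i) (p (i + 1))"
proof -
  note c = chainD[OF assms]
  have "Y i \<inter> Y (i + 1) = {}" using c clique_disjoint by blast
  then show "prox (Y i) K (q i) (p (i + 1))" "prox (Y (i + 1)) K (q i) (p (i + 1))"
    using prox_edge[of "q i" "p (i + 1)"] c(1,2,3,6) by blast+
qed

text \<open>Behrstock's inequality for \<open>Y i\<close> and \<open>Y (i + 1)\<close>; the bound
  \<open>2 * K\<close> grows by \<open>K\<close> when one end of the connecting edge is replaced by
  the other.\<close>

lemma chain_propagate:
  assumes "chain Y p q" "x \<in> V" "\<not> prox (Y i) (3 * K) x (q i)"
  shows "prox (Y (i + 1)) (3 * K) x (p (i + 1))"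
proof -
  note c = chainD[OF assms(1)] and e = chain_exit_proj[OF assms(1), of i]
  have "prox (Y i) (2 * K) x (p (i + 1)) \<or> prox (Y (i + 1)) (2 * K) x (q i)"
    using behrstock[of "Y i" "Y (i + 1)" x "q i" "p (i + 1)"] c assms(2) by blast
  moreover have "\<not> prox (Y i) (2 * K) x (p (i + 1))"
    using prox_trans_le[OF _ prox_sym[OF e(1)]] assms(3) by force
  ultimately show ?thesis using prox_trans_le[OF _ e(2)] by force
qed

text \<open>Entry and exit points are more than \<open>15 * K\<close> apart, which drives the later
  contradictions about chains.\<close>

lemma chain_not_both:
  assumes "chain Y p q" "prox (Y i) m x (p i)" "prox (Y i) n x (q i)"
  shows "15 * K < m + n"
  using chainD(8)[OF assms(1)] prox_trans[OF prox_sym[OF assms(2)] assms(3)] not_le by blast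

lemma K_pos: "0 < K" by (simp add: K_def)

text \<open>Closeness to the entry point excludes closeness to the exit point, as
  \<open>6 * K < 15 * K\<close>; then \<open>chain_propagate\<close> leads to the next
  clique.\<close>

lemma chain_forward:
  assumes "chain Y p q" "x \<in> V" "prox (Y i) (3 * K) x (p i)" "i \<le> j"
  shows "prox (Y j) (3 * K) x (p j)"
  using assms(4)
proof (induction j rule: int_ge_induct)
  case (step j)
  then show ?case
    using chain_propagate[OF assms(1,2), of j] chain_not_both[OF assms(1), of j "3 * K" x "3 * K"] K_pos
    by fastforce
qed (rule assms(3))

text \<open>The same induction in the other direction, with \<open>chain_propagate\<close> read
  contrapositively.\<close>

lemma chain_backward:
  assumes "chain Y p q" "x \<in> V" "prox (Y i) (3 * K) x (q i)" "j \<le> i"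
  shows "prox (Y j) (3 * K) x (q j)"
  using assms(4)
proof (induction j rule: int_le_induct)
  case (step j)
  then show ?case
    using chain_propagate[OF assms(1,2), of "j - 1"]
      chain_not_both[OF assms(1), of j "3 * K" x "3 * K"] K_pos by fastforce
qed (rule assms(3))

text \<open>Together with \<open>chain_proj_backward\<close> this makes the order of a chain visible
  in projections, which later forces the matching of two chains to be monotone.\<close>

lemma chain_proj_forward:
  assumes "chain Y p q" "x \<in> Y i" "i < j"
  shows "prox (Y j) (3 * K) x (p j)"
proof (rule chain_forward[OF assms(1)])
  note c = chainD[OF assms(1)]
  show "x \<in> V" using c assms clique_subset by blast
  have "prox (Y (i + 1)) K x (q i)" using prox_clique[of "Y (i + 1)" "Y i" x "q i"] c assms by metis
  then show "prox (Y (i + 1)) (3 * K) x (p (i + 1))"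
    using prox_trans_le[OF _ chain_exit_proj(2)[OF assms(1)]] by force
  show "i + 1 \<le> j" using assms by simp
qed

lemma chain_proj_backward:
  assumes "chain Y p q" "x \<in> Y i" "j < i"
  shows "prox (Y j) (3 * K) x (q j)"
proof (rule chain_backward[OF assms(1)])
  note c = chainD[OF assms(1)]
  show "x \<in> V" using c assms clique_subset by blast
  have "prox (Y (i - 1)) K x (p i)"
    using prox_clique[of "Y (i - 1)" "Y i" x "p i"] c(1,2) c(7)[of "i - 1"] assms by simp
  then show "prox (Y (i - 1)) (3 * K) x (q (i - 1))"
    using prox_trans_le[OF _ prox_sym[OF chain_exit_proj(1)[OF assms(1), of "i - 1"]]] by force
  show "j \<le> i - 1" using assms by simp
qed

text \<open>A repeated clique would contain \<open>q j\<close>, which is its own projection and yet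
  would have to project near \<open>p j\<close>.\<close>

lemma chain_inj:
  assumes "chain Y p q"
  shows "inj Y"
proof (rule linorder_inj_onI')
  fix i j :: int
  assume "i < j"
  show "Y i \<noteq> Y j"
  proof
    assume "Y i = Y j"
    then have "prox (Y j) (3 * K) (q j) (p j)"
      using chain_proj_forward[OF assms _ \<open>i < j\<close>, of "q j"] chainD[OF assms] by blast
    then show False using chain_not_both[OF assms, of j "3 * K" "q j" 0] K_pos by auto
  qed
qed

text \<open>Fix \<open>x\<close> in \<open>Z\<close>. Where \<open>x\<close> projects near the exit
  point of \<open>Y i\<close>, the part of the chain before \<open>i\<close> is collapsed in
  \<open>Z\<close>; where it does not, the part after \<open>i + 1\<close> is. At an index where the
  behaviour switches the two collapsed parts meet.\<close>

lemma proj_foreign_chain_le: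
  assumes ch: "chain Y p q" and Z: "Z \<in> cliques" "\<And>i. Y i \<noteq> Z" and "m \<le> m'"
  shows "prox Z (7 * K) (p m) (p m')"
proof -
  note c = chainD[OF ch]
  obtain x where x: "x \<in> Z" using clique_nonempty Z by blast
  have xV: "x \<in> V" using x clique_subset Z by blast
  \<comment> \<open>\<open>x\<close> projects near \<open>q i\<close> and \<open>p m\<close> near
    \<open>p i\<close>, so they are far apart in \<open>Y i\<close>, and Behrstock's inequality
    makes \<open>p m\<close> and \<open>q i\<close> close in \<open>Z\<close>.\<close>
  have left: "prox Z (2 * K) (p m) (q i)" if "prox (Y i) (3 * K) x (q i)" "m \<le> i" for i
  proof -
    have "prox (Y i) (3 * K) (p m) (p i)"
      using that(2) chain_proj_forward[OF ch c(2)] by (cases "m = i") auto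
    then have "\<not> prox (Y i) (2 * K) (p m) x"
      using chain_not_both[OF ch, of i "3 * K" "p m" "5 * K"] prox_trans_le[OF _ that(1)] K_pos
      by fastforce
    then show ?thesis using behrstock[OF c(1) Z(1) Z(2) c(4) c(3) x] by blast
  qed
  have right: "prox Z (2 * K) (p m') (p i)" if "prox (Y i) (3 * K) x (p i)" "i < m'" for i
  proof -
    have "prox (Y i) (3 * K) (p m') (q i)"
      using that(2) chain_proj_backward[OF ch c(2)] by auto
    then have "\<not> prox (Y i) (2 * K) (p m') x"
      using chain_not_both[OF ch, of i "5 * K" "p m'" "3 * K"] prox_trans_le[OF _ that(1)] K_pos
      by fastforce
    then show ?thesis using behrstock[OF c(1) Z(1) Z(2) c(4) c(2) x] by blast
  qed
  have in_clique: "prox Z K (p i) (q i)" for i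
    using prox_clique[OF Z(1) c(1) Z(2)[symmetric] c(2,3)] .
  have "Z \<inter> Y i = {}" for i using clique_disjoint[OF Z(1) c(1)] Z(2) by blast
  then have link: "prox Z K (q i) (p (i + 1))" for i
    using prox_edge[OF c(6) Z(1)] c(3) by blast
  have step: "prox Z (2 * K) (p i) (p (i + 1))" for i
    using prox_trans_le[OF in_clique link] by simp
  show ?thesis
  proof (cases "m = m'")
    case False
    then have mm': "m < m'" using assms by simp
    have after: "prox Z (4 * K) (p i) (p m')" if "\<not> prox (Y i) (3 * K) x (q i)" "i < m'" for i
    proof (cases "i + 1 = m'")
      case True
      then show ?thesis using prox_mono[OF step[of i]] by simp
    next
      case False
      then have "prox Z (2 * K) (p m') (p (i + 1))"
        using right[OF chain_propagate[OF ch xV that(1)]] that(2) by simp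
      from prox_trans_le[OF step prox_sym[OF this]] show ?thesis by simp
    qed
    show ?thesis
    proof (cases "prox (Y m) (3 * K) x (q m)")
      case False
      then show ?thesis using after[OF _ mm'] prox_mono by fastforce
    next
      case True
      define P where "P i \<longleftrightarrow> prox (Y i) (3 * K) x (q i)" for i
      show ?thesis
      proof (cases "P (m' - 1)")
        case True
        have "prox Z (2 * K) (p m) (q (m' - 1))"
          using left True mm' unfolding P_def by simp
        from prox_trans_le[OF this link[of "m' - 1"]] show ?thesis by force
      next
        case False
        \<comment> \<open>At the switch, \<open>left\<close> and \<open>link\<close> lead from
          \<open>p m\<close> to \<open>p (i + 1)\<close> within \<open>3 * K\<close>, and
          \<open>after\<close> leads on to \<open>p m'\<close> within \<open>4 * K\<close>.\<close>
        have "\<exists>i. m \<le> i \<and> i < m' - 1 \<and> P i \<and> \<not> P (i + 1)"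
        proof (rule ccontr)
          assume *: "\<not> ?thesis"
          have "P i" if "m \<le> i" "i \<le> m' - 1" for i
            using that
          proof (induction i rule: int_ge_induct)
            case base
            then show ?case using True P_def by simp
          next
            case (step i)
            then show ?case using * by auto
          qed
          then show False using False mm' by simp
        qed
        then obtain i where i: "m \<le> i" "i < m' - 1" "P i" "\<not> P (i + 1)" by blast
        have "prox Z (3 * K) (p m) (p (i + 1))"
          using prox_trans_le[OF left link, of i] i unfolding P_def by simp
        moreover have "prox Z (4 * K) (p (i + 1)) (p m')"
          using after[of "i + 1"] i unfolding P_def by simp
        ultimately show ?thesis using prox_trans_le by force
      qed
    qed
  qed simp
qed

text \<open>Stands for two bi-infinite paths with the same ends, as seen by each clique
  \<open>Y j\<close>. Arbitrarily early and late indices suffice, and these are what a periodic path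
  supplies.\<close>

definition asymptotic ::
    "(int \<Rightarrow> 'a set) \<Rightarrow> (int \<Rightarrow> 'a) \<Rightarrow> (int \<Rightarrow> 'a) \<Rightarrow> (int \<Rightarrow> 'a) \<Rightarrow> bool" where
  "asymptotic Y p q p' \<longleftrightarrow> (\<forall>j M. (\<exists>m<M. prox (Y j) (4 * K) (p' m) (p j)) \<and>
     (\<exists>m>M. prox (Y j) (4 * K) (p' m) (q j)))"

text \<open>Otherwise \<open>proj_foreign_chain_le\<close> puts the projections of an early and a
  late point of the second chain within \<open>7 * K\<close>, although they are near
  \<open>p j\<close> and \<open>q j\<close>.\<close>

lemma asymptotic_clique:
  assumes ch: "chain Y p q" and ch': "chain Y' p' q'" and as: "asymptotic Y p q p'"
  shows "\<exists>i. Y' i = Y j"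
proof (rule ccontr)
  assume *: "\<nexists>i. Y' i = Y j"
  obtain m where m: "m < 0" "prox (Y j) (4 * K) (p' m) (p j)"
    using as unfolding asymptotic_def by meson
  obtain m' where m': "m' > 0" "prox (Y j) (4 * K) (p' m') (q j)"
    using as unfolding asymptotic_def by meson
  have "prox (Y j) (7 * K) (p' m) (p' m')"
    using proj_foreign_chain_le[OF ch' chainD(1)[OF ch]] * m m' by fastforce
  from prox_trans[OF this m'(2)] have "prox (Y j) (11 * K) (p' m) (q j)" by simp
  then show False using chain_not_both[OF ch m(2)] K_pos by fastforce
qed

text \<open>An early point of the second chain projects within \<open>4 * K\<close> of
  \<open>p j\<close> by \<open>asymptotic\<close> and within \<open>3 * K\<close> of
  \<open>p' i\<close> by the order of its own chain. Late points and exits are alike.\<close>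

lemma asymptotic_near:
  assumes ch: "chain Y p q" and ch': "chain Y' p' q'" and as: "asymptotic Y p q p'"
    and eq: "Y' i = Y j"
  shows "prox (Y j) (7 * K) (p j) (p' i)" "prox (Y j) (7 * K) (q j) (q' i)"
proof -
  obtain m where m: "m < i" "prox (Y j) (4 * K) (p' m) (p j)"
    using as unfolding asymptotic_def by meson
  obtain m' where m': "m' > i" "prox (Y j) (4 * K) (p' m') (q j)"
    using as unfolding asymptotic_def by meson
  show "prox (Y j) (7 * K) (p j) (p' i)"
    using prox_trans_le[OF prox_sym[OF m(2)]] chain_proj_forward[OF ch' chainD(2)[OF ch'] m(1)] eq
    by simp
  show "prox (Y j) (7 * K) (q j) (q' i)"
    using prox_trans_le[OF prox_sym[OF m'(2)]] chain_proj_backward[OF ch' chainD(2)[OF ch'] m'(1)] eq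
    by simp
qed

text \<open>Matching equal cliques gives a bijection \<open>\<sigma>\<close> of the integers. It
  preserves the order, hence is a translation.\<close>

lemma asymptotic_shift:
  assumes ch: "chain Y p q" and ch': "chain Y' p' q'"
    and as: "asymptotic Y p q p'" and as': "asymptotic Y' p' q' p"
  obtains s where "\<And>i. Y' i = Y (i + s)"
    "\<And>i. near (Y (i + s)) (7 * K) (p (i + s)) (p' i)" "\<And>i. near (Y (i + s)) (7 * K) (q (i + s)) (q' i)"
proof -
  define \<sigma> where "\<sigma> i = (SOME j. Y j = Y' i)" for i
  have \<sigma>: "Y (\<sigma> i) = Y' i" for i
    unfolding \<sigma>_def using someI_ex[OF asymptotic_clique[OF ch' ch as', of i]] .
  have inj: "\<sigma> i \<noteq> \<sigma> i'" if "i \<noteq> i'" for i i'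
    using that \<sigma> chain_inj[OF ch'] by (metis injD)
  have "surj \<sigma>"
    using asymptotic_clique[OF ch ch' as] \<sigma> chain_inj[OF ch] by (metis injD surjI)
  moreover have "strict_mono \<sigma>"
  proof (rule strict_monoI, rule ccontr)
    fix i i' :: int
    assume "i < i'" "\<not> \<sigma> i < \<sigma> i'"
    \<comment> \<open>For an inversion, the clique \<open>Y (\<sigma> i')\<close> comes after
      \<open>Y' i\<close> in one chain and before it in the other, so \<open>p' i\<close> projects
      near both its entry and its exit point.\<close>
    then have lt: "\<sigma> i' < \<sigma> i" using inj[of i i'] by linarith
    have "prox (Y' i') (3 * K) (p' i) (p' i')"
      using chain_proj_forward[OF ch' chainD(2)[OF ch'] \<open>i < i'\<close>] .
    moreover have "prox (Y' i') (7 * K) (p' i') (p (\<sigma> i'))"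
      using asymptotic_near(1)[OF ch ch' as \<sigma>[symmetric], THEN prox_sym] \<sigma> by simp
    ultimately have "prox (Y (\<sigma> i')) (10 * K) (p' i) (p (\<sigma> i'))"
      using prox_trans_le \<sigma> by force
    moreover have "prox (Y (\<sigma> i')) (3 * K) (p' i) (q (\<sigma> i'))"
      using chain_proj_backward[OF ch _ lt] \<sigma> chainD(2)[OF ch'] by metis
    ultimately show False using chain_not_both[OF ch] K_pos by fastforce
  qed
  ultimately have shift: "\<sigma> i = i + \<sigma> 0" for i
    using strict_mono_surj_int_shift by blast
  have Y': "Y' i = Y (i + \<sigma> 0)" for i using \<sigma> shift by metis
  show thesis
  proof (rule that)
    fix i
    have "p' i \<in> Y (i + \<sigma> 0)" "q' i \<in> Y (i + \<sigma> 0)"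
      using chainD(2,3)[OF ch', of i] Y' by auto
    note * = this asymptotic_near[OF ch ch' as Y', of i] chainD(1,2,3)[OF ch, of "i + \<sigma> 0"]
    from * show "near (Y (i + \<sigma> 0)) (7 * K) (p (i + \<sigma> 0)) (p' i)"
      by (simp add: prox_near)
    from * show "near (Y (i + \<sigma> 0)) (7 * K) (q (i + \<sigma> 0)) (q' i)"
      by (simp add: prox_near)
  qed (rule Y')
qed

end


section \<open>Cosets of a hyperbolically embedded subgroup\<close>

lemma path_dist_le: "(u, v) \<in> E ^^ n \<Longrightarrow> path_dist E u v \<le> enat n"
  unfolding path_dist_def by (rule INF_lower) simp

lemma path_dist_walk:
  assumes "path_dist E u v \<noteq> \<infinity>"
  shows "(u, v) \<in> E ^^ the_enat (path_dist E u v)"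
proof -
  let ?A = "enat ` {n. (u, v) \<in> E ^^ n}"
  have ne: "?A \<noteq> {}" using assms unfolding path_dist_def by (metis Inf_enat_def)
  then have "Inf ?A \<in> ?A" unfolding Inf_enat_def using LeastI[of "\<lambda>x. x \<in> ?A"] by (metis ex_in_conv)
  then obtain n where "Inf ?A = enat n" "(u, v) \<in> E ^^ n" by blast
  then show ?thesis by (simp add: path_dist_def)
qed

lemma relpow_map:
  assumes "\<And>x y. (x, y) \<in> R \<Longrightarrow> (f x, f y) \<in> R'" "(x, y) \<in> R ^^ n"
  shows "(f x, f y) \<in> R' ^^ n"
  using assms(2)
proof (induction n arbitrary: y)
  case (Suc n)
  then show ?case using assms(1) by (auto intro: relpow_Suc_I)
qed auto

definition cayley_dist :: "('a, 'b) monoid_scheme \<Rightarrow> 'a set \<Rightarrow> 'a \<Rightarrow> 'a \<Rightarrow> nat" where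
  "cayley_dist G S u v = the_enat (path_dist (cayley_graph G S) u v)"

text \<open>In each case of the minimum one distance to \<open>w\<close> cancels. Doubling turns the
  error into \<open>2 * \<delta>\<close>, which is rounded up to an integer.\<close>

lemma gromov_hyperbolic_four_point:
  fixes d :: "'a \<Rightarrow> 'a \<Rightarrow> nat"
  assumes "gromov_hyperbolic M (\<lambda>u v. real (d u v))"
  obtains \<Delta> :: nat where "\<And>x y z w. \<lbrakk>x \<in> M; y \<in> M; z \<in> M; w \<in> M\<rbrakk> \<Longrightarrow>
    d x z + d y w \<le> max (d x y + d z w) (d y z + d x w) + \<Delta>"
proof -
  obtain \<delta> where \<delta>: "\<forall>x\<in>M. \<forall>y\<in>M. \<forall>z\<in>M. \<forall>w\<in>M.
     gromov_product d w x z \<ge> min (gromov_product d w x y) (gromov_product d w y z) - \<delta>"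
    using assms unfolding gromov_hyperbolic_def by blast
  show thesis
  proof (rule that[of "nat \<lceil>2 * \<delta>\<rceil>"])
    fix x y z w assume "x \<in> M" "y \<in> M" "z \<in> M" "w \<in> M"
    then have "gromov_product d w x z \<ge> min (gromov_product d w x y) (gromov_product d w y z) - \<delta>"
      using \<delta> by blast
    then consider "gromov_product d w x z \<ge> gromov_product d w x y - \<delta>"
      | "gromov_product d w x z \<ge> gromov_product d w y z - \<delta>" by linarith
    moreover have "2 * \<delta> \<le> real (nat \<lceil>2 * \<delta>\<rceil>)" by linarith
    ultimately have "real (d x z + d y w) \<le> real (d x y + d z w) + real (nat \<lceil>2 * \<delta>\<rceil>) \<or>
        real (d x z + d y w) \<le> real (d y z + d x w) + real (nat \<lceil>2 * \<delta>\<rceil>)"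
      unfolding gromov_product_def of_nat_add by cases argo+
    then show "d x z + d y w \<le> max (d x y + d z w) (d y z + d x w) + nat \<lceil>2 * \<delta>\<rceil>"
      by linarith
  qed
qed

text \<open>The letter \<open>a\<close> is used to leave cosets: \<open>a \<in> X\<close> makes the
  passage a single edge, and \<open>a \<notin> H\<close> makes consecutive cosets differ.\<close>

locale hyp_embedded_pair = group G for G (structure) +
  fixes H X :: "'a set" and a :: 'a and \<Delta> :: nat
  assumes emb: "hyp_embedded_wrt G H X"
    and a_X: "a \<in> X" and a_H: "a \<notin> H"
    and four: "\<And>x y z w. \<lbrakk>x \<in> carrier G; y \<in> carrier G; z \<in> carrier G; w \<in> carrier G\<rbrakk> \<Longrightarrow>
      cayley_dist G (X \<union> H) x z + cayley_dist G (X \<union> H) y w \<le>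
      max (cayley_dist G (X \<union> H) x y + cayley_dist G (X \<union> H) z w)
        (cayley_dist G (X \<union> H) y z + cayley_dist G (X \<union> H) x w) + \<Delta>"
begin

lemma subgroup_H: "subgroup H G"
  using emb by (simp add: hyp_embedded_wrt_def)

lemma H_carrier: "h \<in> H \<Longrightarrow> h \<in> carrier G"
  by (rule subgroup.mem_carrier[OF subgroup_H])

lemma X_carrier: "X \<subseteq> carrier G"
  using emb by (simp add: hyp_embedded_wrt_def)

lemma a_carrier [simp]: "a \<in> carrier G"
  using a_X X_carrier by blast

lemma cancel_left:
  assumes "x \<in> carrier G" "y \<in> carrier G"
  shows "inv x \<otimes> (x \<otimes> y) = y" "x \<otimes> (inv x \<otimes> y) = y"
  using assms by (simp_all flip: m_assoc)

lemma mem_coset: "p \<in> carrier G \<Longrightarrow> x \<in> p <# H \<longleftrightarrow> (x \<in> carrier G \<and> inv p \<otimes> x \<in> H)"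
proof
  assume p: "p \<in> carrier G"
  show "x \<in> carrier G \<and> inv p \<otimes> x \<in> H" if "x \<in> p <# H"
    using that p H_carrier by (auto simp: l_coset_def cancel_left)
  show "x \<in> p <# H" if "x \<in> carrier G \<and> inv p \<otimes> x \<in> H"
    using that p by (auto simp: l_coset_def cancel_left intro!: bexI[of _ "inv p \<otimes> x"])
qed

lemma coset_translate:
  assumes "t \<in> carrier G" "p \<in> carrier G" "x \<in> carrier G"
  shows "t \<otimes> x \<in> (t \<otimes> p) <# H \<longleftrightarrow> x \<in> p <# H"
  using assms by (simp add: mem_coset inv_mult_group m_assoc cancel_left)

lemma coset_eqI: "\<lbrakk>x \<in> p <# H; p \<in> carrier G\<rbrakk> \<Longrightarrow> x <# H = p <# H"
  using l_repr_independence subgroup_H by metis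

lemma translate_edge:
  assumes "(x, y) \<in> cayley_graph G S" "t \<in> carrier G" "S \<subseteq> carrier G"
  shows "(t \<otimes> x, t \<otimes> y) \<in> cayley_graph G S"
  using assms unfolding cayley_graph_def by (force simp: m_assoc)

sublocale hyperbolic_cliques "carrier G" "cayley_graph G (X \<union> H)" "{g <# H | g. g \<in> carrier G}"
  "cayley_dist G (X \<union> H)" \<Delta>
proof
  \<comment> \<open>\<open>cayley_dist\<close> is meaningful only where \<open>path_dist\<close> is
    finite, because \<open>the_enat\<close> is unspecified at infinity.\<close>
  have conn: "path_dist (cayley_graph G (X \<union> H)) u v \<noteq> \<infinity>"
    if "u \<in> carrier G" "v \<in> carrier G" for u v
    using emb that unfolding hyp_embedded_wrt_def hyperbolic_graph_def by blast
  show "cayley_graph G (X \<union> H) \<subseteq> carrier G \<times> carrier G"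
    by (auto simp: cayley_graph_def)
  show "sym (cayley_graph G (X \<union> H))"
    by (auto simp: cayley_graph_def sym_def)
  show "(x, y) \<in> cayley_graph G (X \<union> H) ^^ cayley_dist G (X \<union> H) x y"
    if "x \<in> carrier G" "y \<in> carrier G" for x y
    unfolding cayley_dist_def by (rule path_dist_walk[OF conn[OF that]])
  show "cayley_dist G (X \<union> H) x y \<le> n" if "(x, y) \<in> cayley_graph G (X \<union> H) ^^ n" for x y n
    using path_dist_le[OF that] unfolding cayley_dist_def
    by (metis enat_ord_simps(1) enat_ord_simps(5) the_enat.simps enat_ile)
  show "Y \<subseteq> carrier G" "Y \<noteq> {}" if "Y \<in> {g <# H |g. g \<in> carrier G}" for Y
    using that H_carrier subgroup.one_closed[OF subgroup_H] by (auto simp: l_coset_def)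
  show "(y, y') \<in> cayley_graph G (X \<union> H)"
    if Y: "Y \<in> {g <# H |g. g \<in> carrier G}" and y: "y \<in> Y" "y' \<in> Y" for Y y y'
  proof -
    obtain g where g: "g \<in> carrier G" "Y = g <# H" using Y by blast
    obtain h h' where h: "h \<in> H" "h' \<in> H" "y = g \<otimes> h" "y' = g \<otimes> h'"
      using y g by (auto simp: l_coset_def)
    have "y' = y \<otimes> (inv h \<otimes> h')"
      using h g H_carrier by (simp add: m_assoc cancel_left)
    moreover have "inv h \<otimes> h' \<in> H"
      using h subgroup_H by (simp add: subgroup.m_closed subgroup.m_inv_closed)
    ultimately show ?thesis using h g H_carrier unfolding cayley_graph_def by auto
  qed
  show "Y \<inter> Z = {}"
    if "Y \<in> {g <# H |g. g \<in> carrier G}" "Z \<in> {g <# H |g. g \<in> carrier G}" "Y \<noteq> Z" for Y Z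
  proof (rule ccontr)
    assume "Y \<inter> Z \<noteq> {}"
    then obtain x where "x \<in> Y" "x \<in> Z" by blast
    moreover from that(1) obtain g where "Y = g <# H" "g \<in> carrier G" by auto
    moreover from that(2) obtain g' where "Z = g' <# H" "g' \<in> carrier G" by auto
    ultimately have "x <# H = Y" "x <# H = Z" using coset_eqI[of x g] coset_eqI[of x g'] by simp_all
    with that(3) show False by simp
  qed
qed (rule four)

lemma walk_translate:
  assumes "(x, y) \<in> cayley_graph G (X \<union> H) ^^ n" "t \<in> carrier G"
  shows "(t \<otimes> x, t \<otimes> y) \<in> cayley_graph G (X \<union> H) ^^ n"
  by (rule relpow_map[OF _ assms(1)]) (use translate_edge assms X_carrier H_carrier in blast)

lemma dist_translate:
  assumes "t \<in> carrier G" "x \<in> carrier G" "y \<in> carrier G"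
  shows "cayley_dist G (X \<union> H) (t \<otimes> x) (t \<otimes> y) = cayley_dist G (X \<union> H) x y"
proof (rule antisym)
  show "cayley_dist G (X \<union> H) (t \<otimes> x) (t \<otimes> y) \<le> cayley_dist G (X \<union> H) x y"
    using assms by (intro dist_le walk_translate dist_walk) auto
  have "(inv t \<otimes> (t \<otimes> x), inv t \<otimes> (t \<otimes> y)) \<in>
      cayley_graph G (X \<union> H) ^^ cayley_dist G (X \<union> H) (t \<otimes> x) (t \<otimes> y)"
    using assms by (intro walk_translate dist_walk) auto
  then show "cayley_dist G (X \<union> H) x y \<le> cayley_dist G (X \<union> H) (t \<otimes> x) (t \<otimes> y)"
    using assms by (intro dist_le) (simp add: cancel_left)
qed

lemma near_translate:
  assumes "near (p <# H) n u v" "t \<in> carrier G" "p \<in> carrier G"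
  shows "near ((t \<otimes> p) <# H) n (t \<otimes> u) (t \<otimes> v)"
proof -
  obtain m where m: "m \<le> n" "(u, v) \<in> (cayley_graph G (X \<union> H) - (p <# H) \<times> (p <# H)) ^^ m"
    using assms(1) unfolding near_def by blast
  have "(t \<otimes> u, t \<otimes> v) \<in> (cayley_graph G (X \<union> H) - ((t \<otimes> p) <# H) \<times> ((t \<otimes> p) <# H)) ^^ m"
  proof (rule relpow_map[OF _ m(2)])
    fix x y assume xy: "(x, y) \<in> cayley_graph G (X \<union> H) - (p <# H) \<times> (p <# H)"
    then have "x \<in> carrier G" "y \<in> carrier G" by (auto simp: cayley_graph_def)
    then show "(t \<otimes> x, t \<otimes> y) \<in>
        cayley_graph G (X \<union> H) - ((t \<otimes> p) <# H) \<times> ((t \<otimes> p) <# H)"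
      using xy translate_edge[of x y "X \<union> H" t] assms X_carrier H_carrier coset_translate[OF assms(2,3)]
      by auto
  qed
  then show ?thesis using m(1) unfolding near_def by blast
qed

text \<open>The ball about the identity for the relative metric on \<open>H\<close>; by translation
  it describes closeness in every coset.\<close>

definition rel_ball :: "nat \<Rightarrow> 'a set" where
  "rel_ball n = {k \<in> H. near H n \<one> k}"

text \<open>The Cayley graph of \<open>H\<close> with respect to \<open>H\<close> is
  \<open>H \<times> H\<close>, loops included, so \<open>near H\<close> and
  \<open>relative_dist\<close> remove the same edges and local finiteness applies.\<close>

lemma finite_rel_ball: "finite (rel_ball n)"
proof -
  have "cayley_graph (G\<lparr>carrier := H\<rparr>) H = H \<times> H"
  proof -
    have "y = x \<otimes> (inv x \<otimes> y)" "inv x \<otimes> y \<in> H" if "x \<in> H" "y \<in> H" for x y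
      using that H_carrier subgroup_H
      by (simp_all add: cancel_left subgroup.m_closed subgroup.m_inv_closed)
    then show ?thesis by (auto simp: cayley_graph_def) blast
  qed
  then have "relative_dist G H X \<one> k \<le> enat n" if "k \<in> rel_ball n" for k
    using that unfolding rel_ball_def near_def relative_dist_def
    by (auto intro: order_trans[OF path_dist_le])
  then have "rel_ball n \<subseteq> {k \<in> H. relative_dist G H X \<one> k \<le> enat n}"
    by (auto simp: rel_ball_def)
  moreover have "finite {k \<in> H. relative_dist G H X \<one> k \<le> enat n}"
    using emb subgroup.one_closed[OF subgroup_H] unfolding hyp_embedded_wrt_def by blast
  ultimately show ?thesis by (rule finite_subset)
qed

lemma near_coset_iff:
  assumes "p \<in> carrier G" "u \<in> p <# H" "v \<in> p <# H"
  shows "near (p <# H) n u v \<longleftrightarrow> inv u \<otimes> v \<in> rel_ball n"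
proof -
  have u: "u \<in> carrier G" "v \<in> carrier G" using assms mem_coset by blast+
  have uH: "u <# H = p <# H" using assms coset_eqI by blast
  have 1: "\<one> <# H = H" using subgroup_H lcos_mult_one subgroup.subset by blast
  have "inv u \<otimes> v \<in> H" using assms uH u mem_coset by blast
  moreover have "near (u <# H) n u v \<longleftrightarrow> near H n \<one> (inv u \<otimes> v)"
    using near_translate[of u n u v "inv u"] near_translate[of \<one> n \<one> "inv u \<otimes> v" u] u 1
    by (auto simp: cancel_left)
  ultimately show ?thesis using uH by (simp add: rel_ball_def)
qed

text \<open>A fixed geodesic from \<open>p 0\<close> to \<open>p' 0\<close>, translated by
  \<open>z [^] k\<close>, joins \<open>p (k * N)\<close> to \<open>p' (k * N)\<close>. If these have
  far projections to \<open>Y j\<close>, the translate meets \<open>Y j\<close>, so the fixed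
  geodesic meets \<open>Y (j - k * N)\<close>. Finitely many vertices and disjoint cliques allow
  this for finitely many \<open>k\<close> only.\<close>

lemma asymptotic_periodic:
  assumes ch: "chain Y p q" and Y: "\<And>i. Y i = p i <# H"
    and z: "z \<in> carrier G" and N: "N > 0"
    and per: "\<And>i k::int. p (i + k * N) = z [^] k \<otimes> p i"
    and p': "p' 0 \<in> carrier G" and per': "\<And>k. p' (k * N) = z [^] k \<otimes> p' 0"
  shows "asymptotic Y p q p'"
proof -
  note c = chainD[OF ch]
  define n where "n = cayley_dist G (X \<union> H) (p 0) (p' 0)"
  obtain \<gamma> where \<gamma>: "\<gamma> 0 = p 0" "\<gamma> n = p' 0" "\<forall>i<n. (\<gamma> i, \<gamma> (Suc i)) \<in> cayley_graph G (X \<union> H)"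
    using dist_walk[OF c(4) p'] unfolding relpow_fun_conv n_def by blast
  define bad where "bad j = {k. \<not> prox (Y j) K (p (k * N)) (p' (k * N))}" for j
  have "finite (bad j)" for j
  proof -
    have "\<exists>i<n. \<gamma> i \<in> Y (j + (- k) * N)" if kbad: "k \<in> bad j" for k
    proof -
      have zk: "z [^] k \<in> carrier G" using z by simp
      have p0: "p (k * N) = z [^] k \<otimes> p 0" using per[of 0 k] by simp
      have dn: "cayley_dist G (X \<union> H) (p (k * N)) (p' (k * N)) = n"
        using dist_translate[OF zk c(4) p'] by (simp add: p0 per' n_def)
      obtain i where i: "i < n" "z [^] k \<otimes> \<gamma> i \<in> Y j"
      proof (rule geodesic_edge_if_not_prox[of "\<lambda>i. z [^] k \<otimes> \<gamma> i" "p (k * N)" "p' (k * N)" "Y j"])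
        show "\<forall>i<cayley_dist G (X \<union> H) (p (k * N)) (p' (k * N)).
            (z [^] k \<otimes> \<gamma> i, z [^] k \<otimes> \<gamma> (Suc i)) \<in> cayley_graph G (X \<union> H)"
          using \<gamma>(3) translate_edge zk X_carrier H_carrier unfolding dn by blast
      qed (use \<gamma> p0 per' dn zk c p' kbad in \<open>auto simp: bad_def\<close>)
      have \<gamma>i: "\<gamma> i \<in> carrier G" using \<gamma>(3) i(1) by (auto simp: cayley_graph_def)
      have pj: "p (j + (- k) * N) \<in> carrier G" by (rule c(4))
      have "p j = z [^] k \<otimes> p (j + (- k) * N)" using per[of "j + (- k) * N" k] by simp
      then have "\<gamma> i \<in> Y (j + (- k) * N)"
        using i(2) coset_translate[OF zk pj \<gamma>i] by (simp add: Y)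
      with i(1) show ?thesis by blast
    qed
    then have "bad j \<subseteq> (\<Union>i<n. {k. \<gamma> i \<in> Y (j + (- k) * N)})" by blast
    moreover have "finite {k. \<gamma> i \<in> Y (j + (- k) * N)}" for i
    proof (cases "\<exists>k. \<gamma> i \<in> Y (j + (- k) * N)")
      case True
      then obtain k where k: "\<gamma> i \<in> Y (j + (- k) * N)" by blast
      have "k' = k" if "\<gamma> i \<in> Y (j + (- k') * N)" for k'
      proof -
        have "Y (j + (- k') * N) = Y (j + (- k) * N)"
          using clique_disjoint[OF c(1) c(1)] that k by blast
        then show ?thesis using injD[OF chain_inj[OF ch], of "j + (- k') * N" "j + (- k) * N"] N by simp
      qed
      then have "{k. \<gamma> i \<in> Y (j + (- k) * N)} \<subseteq> {k}" by blast
      then show ?thesis by (rule finite_subset) simp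
    qed simp
    ultimately show ?thesis by (auto intro: finite_subset)
  qed
  have low: "\<exists>k<b. k \<notin> bad j" for b j
    by (meson \<open>finite (bad j)\<close> finite_subset infinite_Iio lessThan_iff subsetI)
  have high: "\<exists>k>b. k \<notin> bad j" for b j
    by (meson \<open>finite (bad j)\<close> finite_subset infinite_Ioi greaterThan_iff subsetI)
  show ?thesis
    unfolding asymptotic_def
  proof (intro allI conjI)
    fix j M
    \<comment> \<open>\<open>k < 0\<close> gives \<open>k * N \<le> k\<close>, so the index is below
      both \<open>M\<close> and \<open>j\<close>. The bound \<open>4 * K\<close> is \<open>K\<close>
      from \<open>k \<notin> bad j\<close> plus \<open>3 * K\<close> from the order of the
      chain.\<close>
    obtain k where k: "k < min 0 (min M j)" "k \<notin> bad j" using low by blast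
    have "k * N \<le> k" using k N by (simp add: mult_le_cancel_left1)
    then have lt: "k * N < M" "k * N < j" using k by linarith+
    have "prox (Y j) (4 * K) (p' (k * N)) (p j)"
      using prox_trans_le[OF prox_sym chain_proj_forward[OF ch c(2) lt(2)]] k by (auto simp: bad_def)
    then show "\<exists>m<M. prox (Y j) (4 * K) (p' m) (p j)" using lt by blast
  next
    fix j M
    obtain k where k: "k > max 0 (max M j)" "k \<notin> bad j" using high by blast
    have "k \<le> k * N" using k N by (simp add: mult_le_cancel_left1)
    then have lt: "M < k * N" "j < k * N" using k by linarith+
    have "prox (Y j) (4 * K) (p' (k * N)) (q j)"
      using prox_trans_le[OF prox_sym chain_proj_backward[OF ch c(2) lt(2)]] k by (auto simp: bad_def)
    then show "\<exists>m>M. prox (Y j) (4 * K) (p' m) (q j)" using lt by blast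
  qed
qed


section \<open>Periodic words\<close>

text \<open>Conjugation by \<open>t\<close> is a homomorphism that sends \<open>x\<close> to
  \<open>y\<close>.\<close>

lemma intertwine_int_pow:
  assumes "t \<in> carrier G" "x \<in> carrier G" "y \<in> carrier G" "t \<otimes> x = y \<otimes> t"
  shows "t \<otimes> x [^] (k::int) = y [^] k \<otimes> t"
proof -
  have "(\<lambda>x. t \<otimes> x \<otimes> inv t) \<in> hom G G"
    using assms(1) by (auto simp: hom_def m_assoc cancel_left)
  then have "t \<otimes> x [^] k \<otimes> inv t = (t \<otimes> x \<otimes> inv t) [^] k"
    using hom_int_pow[of _ G G x k] assms(2) is_group by blast
  also have "t \<otimes> x \<otimes> inv t = y" using assms by (simp add: m_assoc)
  finally have "t \<otimes> x [^] k \<otimes> inv t \<otimes> t = y [^] k \<otimes> t" by simp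
  then show ?thesis using assms by (simp add: m_assoc)
qed

primrec word_prod :: "'a list \<Rightarrow> 'a" where
  "word_prod [] = \<one>"
| "word_prod (h # w) = h \<otimes> a \<otimes> word_prod w"

definition letter :: "'a list \<Rightarrow> int \<Rightarrow> 'a" where
  "letter w i = w ! nat (i mod int (length w))"

text \<open>The vertex at which the bi-infinite path through \<open>\<one>\<close> with label
  \<open>w\<close> repeated enters its coset number \<open>i\<close>. As \<open>div\<close> and
  \<open>mod\<close> round down on integers, the formula also covers negative
  \<open>i\<close>.\<close>

definition pos :: "'a list \<Rightarrow> int \<Rightarrow> 'a" where
  "pos w i = word_prod w [^] (i div int (length w)) \<otimes> word_prod (take (nat (i mod int (length w))) w)"

lemma word_prod_carrier: "set w \<subseteq> H \<Longrightarrow> word_prod w \<in> carrier G"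
  by (induction w) (auto simp: H_carrier)

lemma word_prod_snoc: "\<lbrakk>set w \<subseteq> H; h \<in> H\<rbrakk> \<Longrightarrow> word_prod (w @ [h]) = word_prod w \<otimes> h \<otimes> a"
  by (induction w) (auto simp: H_carrier word_prod_carrier m_assoc)

lemma pos_carrier: "set w \<subseteq> H \<Longrightarrow> pos w i \<in> carrier G"
  unfolding pos_def by (meson int_pow_closed m_closed set_take_subset subset_trans word_prod_carrier)

lemma letter_in_set: "w \<noteq> [] \<Longrightarrow> letter w i \<in> set w"
  unfolding letter_def by (rule nth_mem) (simp add: nat_less_iff)

lemma pos_Suc:
  assumes w: "set w \<subseteq> H" "w \<noteq> []"
  shows "pos w (i + 1) = pos w i \<otimes> letter w i \<otimes> a"
proof -
  define N where "N = int (length w)"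
  define r where "r = nat (i mod N)"
  have N: "0 < N" using w by (simp add: N_def)
  have r: "int r = i mod N" "r < length w" using N by (simp_all add: r_def N_def nat_less_iff)
  have tk: "set (take r w) \<subseteq> H" using w set_take_subset by fast
  have lH: "w ! r \<in> H" using r w by auto
  have Suc_r: "word_prod (take (Suc r) w) = word_prod (take r w) \<otimes> w ! r \<otimes> a"
    using word_prod_snoc[OF tk lH] r by (simp add: take_Suc_conv_app_nth)
  have gc: "word_prod w \<in> carrier G" using w word_prod_carrier by blast
  have tc: "word_prod (take r w) \<in> carrier G" using tk word_prod_carrier by blast
  have lhs: "pos w i \<otimes> letter w i \<otimes> a = word_prod w [^] (i div N) \<otimes> word_prod (take (Suc r) w)"
    unfolding pos_def letter_def Suc_r using gc tc lH H_carrier by (simp add: m_assoc N_def[symmetric] r_def[symmetric])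
  show ?thesis
  proof (cases "i mod N + 1 = N")
    \<comment> \<open>Letter \<open>i\<close> ends the period: the quotient goes up by one, the
      remainder returns to 0, and the prefix becomes all of \<open>w\<close>.\<close>
    case True
    then have "i + 1 = N * (i div N + 1)"
      using mult_div_mod_eq[of N i] True by (simp only: distrib_left)
    then have "(i + 1) div N = i div N + 1" "(i + 1) mod N = 0" using N by simp_all
    moreover have "Suc r = length w" using True r N_def by linarith
    ultimately show ?thesis
      unfolding lhs by (simp add: pos_def N_def[symmetric] int_pow_mult gc)
  next
    case False
    have lt: "i mod N + 1 < N" using False N pos_mod_bound[OF N, of i] by linarith
    have *: "i + 1 = (i mod N + 1) + N * (i div N)"
      using mult_div_mod_eq[of N i] by simp
    have ge: "0 \<le> i mod N + 1" using N by simp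
    have "(i + 1) mod N = i mod N + 1"
      by (subst *) (simp only: mod_mult_self2 mod_pos_pos_trivial[OF ge lt])
    moreover have "(i + 1) div N = i div N"
      by (subst *) (simp only: div_mult_self2[OF N[THEN less_imp_neq, symmetric]]
          div_pos_pos_trivial[OF ge lt] add_0_right)
    moreover have "nat (i mod N + 1) = Suc r"
      using r by linarith
    ultimately show ?thesis unfolding lhs by (simp add: pos_def N_def[symmetric])
  qed
qed

lemma pos_period:
  assumes "set w \<subseteq> H" "w \<noteq> []"
  shows "pos w (i + k * int (length w)) = word_prod w [^] k \<otimes> pos w i"
  using assms word_prod_carrier[of w] word_prod_carrier[of "take (nat (i mod int (length w))) w"]
    set_take_subset[of "nat (i mod int (length w))" w]
  by (simp add: pos_def int_pow_mult m_assoc add.commute)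

text \<open>\<open>letter w i\<close> moves far within a coset by \<open>far\<close>, and
  \<open>a \<notin> H\<close> leads to a different coset. The factor \<open>t\<close> covers the
  translated paths that arise from conjugation.\<close>

lemma word_chain:
  assumes w: "set w \<subseteq> H" "w \<noteq> []" and far: "set w \<inter> rel_ball (15 * K) = {}"
    and t: "t \<in> carrier G"
  shows "chain (\<lambda>i. (t \<otimes> pos w i) <# H) (\<lambda>i. t \<otimes> pos w i) (\<lambda>i. t \<otimes> pos w i \<otimes> letter w i)"
proof -
  have "(t \<otimes> pos w i) <# H \<in> {g <# H |g. g \<in> carrier G} \<and> t \<otimes> pos w i \<in> (t \<otimes> pos w i) <# H \<and>
      t \<otimes> pos w i \<otimes> letter w i \<in> (t \<otimes> pos w i) <# H \<and>
      (t \<otimes> pos w i \<otimes> letter w i, t \<otimes> pos w (i + 1)) \<in> cayley_graph G (X \<union> H) \<and>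
      (t \<otimes> pos w i) <# H \<noteq> (t \<otimes> pos w (i + 1)) <# H \<and>
      \<not> near ((t \<otimes> pos w i) <# H) (15 * K) (t \<otimes> pos w i) (t \<otimes> pos w i \<otimes> letter w i)" for i
  proof -
    define P where "P = t \<otimes> pos w i"
    define l where "l = letter w i"
    have P: "P \<in> carrier G" using t w pos_carrier by (simp add: P_def)
    have l: "l \<in> H" "l \<in> carrier G" "l \<notin> rel_ball (15 * K)"
      using letter_in_set[OF w(2), of i] w far H_carrier by (auto simp: l_def)
    have next_pos: "t \<otimes> pos w (i + 1) = P \<otimes> l \<otimes> a"
      using pos_Suc[OF w] t pos_carrier[OF w(1)] l by (simp add: P_def l_def m_assoc)
    have mem: "P \<in> P <# H" "P \<otimes> l \<in> P <# H"
      using P l subgroup.one_closed[OF subgroup_H] by (simp_all add: mem_coset cancel_left)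
    have "P \<otimes> l \<otimes> a \<notin> P <# H"
    proof
      assume "P \<otimes> l \<otimes> a \<in> P <# H"
      then have "l \<otimes> a \<in> H" using P l by (simp add: mem_coset m_assoc cancel_left)
      then have "inv l \<otimes> (l \<otimes> a) \<in> H"
        using l subgroup_H by (simp add: subgroup.m_closed subgroup.m_inv_closed)
      then show False using a_H l by (simp add: cancel_left)
    qed
    moreover have "P \<otimes> l \<otimes> a \<in> (P \<otimes> l \<otimes> a) <# H"
      using P l subgroup.one_closed[OF subgroup_H] by (simp add: mem_coset)
    moreover have "(P \<otimes> l, P \<otimes> l \<otimes> a) \<in> cayley_graph G (X \<union> H)"
      using P l a_X by (auto simp: cayley_graph_def)
    moreover have "\<not> near (P <# H) (15 * K) P (P \<otimes> l)"
      using near_coset_iff[OF P mem] l P by (simp add: cancel_left)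
    ultimately show ?thesis
      unfolding next_pos P_def[symmetric] l_def[symmetric] using P mem by auto
  qed
  then show ?thesis unfolding chain_def by blast
qed

text \<open>Letters outside the ball of radius \<open>15 * K\<close> yield chains. The last
  condition concerns two paths through one coset whose entry points and exit points are within
  \<open>7 * K\<close>, the bound of \<open>asymptotic_shift\<close>: if \<open>k\<close> and
  \<open>k'\<close> are the offsets at entry and exit, the letters are equal.\<close>

definition separated :: "'a set \<Rightarrow> bool" where
  "separated A \<longleftrightarrow> A \<subseteq> H \<and> A \<inter> rel_ball (15 * K) = {} \<and>
     (\<forall>b\<in>A. \<forall>b'\<in>A. \<forall>k\<in>rel_ball (7 * K). \<forall>k'\<in>rel_ball (7 * K). k \<otimes> b' = b \<otimes> k' \<longrightarrow> b = b')"

text \<open>Translation by \<open>t\<close> carries the path of \<open>w'\<close> to one that is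
  invariant under \<open>word_prod w\<close>. Both paths are then periodic under the same element,
  hence asymptotic, and \<open>asymptotic_shift\<close> aligns their cosets.\<close>

lemma separated_conjugate_shift:
  assumes A: "separated A" and w: "set w \<subseteq> A" "set w' \<subseteq> A" "w \<noteq> []" "length w' = length w"
    and t: "t \<in> carrier G" "t \<otimes> word_prod w' = word_prod w \<otimes> t"
  obtains s where "\<And>i. (t \<otimes> pos w' i) <# H = pos w (i + s) <# H"
    "\<And>i. letter w' i = letter w (i + s)"
proof -
  define N where "N = int (length w)"
  have N: "0 < N" using w by (simp add: N_def)
  have AH: "A \<subseteq> H" and far: "A \<inter> rel_ball (15 * K) = {}" using A by (auto simp: separated_def)
  have wH: "set w \<subseteq> H" "set w' \<subseteq> H" and w'0: "w' \<noteq> []" using w AH by auto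
  have far_w: "set w \<inter> rel_ball (15 * K) = {}" "set w' \<inter> rel_ball (15 * K) = {}"
    using w far by blast+
  define g where "g = word_prod w"
  define g' where "g' = word_prod w'"
  have gc: "g \<in> carrier G" "g' \<in> carrier G" using wH word_prod_carrier by (auto simp: g_def g'_def)
  have pc: "pos w i \<in> carrier G" "pos w' i \<in> carrier G" for i using wH pos_carrier by auto
  have ch: "chain (\<lambda>i. pos w i <# H) (pos w) (\<lambda>i. pos w i \<otimes> letter w i)"
    using word_chain[OF wH(1) w(3) far_w(1) one_closed] pc by simp
  have ch': "chain (\<lambda>i. (t \<otimes> pos w' i) <# H) (\<lambda>i. t \<otimes> pos w' i) (\<lambda>i. t \<otimes> pos w' i \<otimes> letter w' i)"
    using word_chain[OF wH(2) w'0 far_w(2) t(1)] .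
  have per: "pos w (i + k * N) = g [^] k \<otimes> pos w i" for i k
    using pos_period[OF wH(1) w(3)] by (simp add: N_def g_def)
  have gk: "t \<otimes> g' [^] k = g [^] k \<otimes> t" for k :: int
    by (rule intertwine_int_pow) (use t gc in \<open>simp_all add: g_def g'_def\<close>)
  have per': "t \<otimes> pos w' (i + k * N) = g [^] k \<otimes> (t \<otimes> pos w' i)" for i k
  proof -
    have "t \<otimes> pos w' (i + k * N) = (t \<otimes> g' [^] k) \<otimes> pos w' i"
      using pos_period[OF wH(2) w'0, of i k] w(4) t gc pc by (simp add: N_def g'_def m_assoc)
    also have "\<dots> = g [^] k \<otimes> (t \<otimes> pos w' i)"
      unfolding gk using t gc pc by (simp add: m_assoc)
    finally show ?thesis .
  qed
  have as: "asymptotic (\<lambda>i. pos w i <# H) (pos w) (\<lambda>i. pos w i \<otimes> letter w i) (\<lambda>i. t \<otimes> pos w' i)"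
    using asymptotic_periodic[OF ch _ gc(1) N per, of "\<lambda>i. t \<otimes> pos w' i"] per'[of 0] t pc by simp
  have as': "asymptotic (\<lambda>i. (t \<otimes> pos w' i) <# H) (\<lambda>i. t \<otimes> pos w' i)
      (\<lambda>i. t \<otimes> pos w' i \<otimes> letter w' i) (pos w)"
    using asymptotic_periodic[OF ch' _ gc(1) N per', of "pos w"] per[of 0] pc by simp
  obtain s where s: "\<And>i. (t \<otimes> pos w' i) <# H = pos w (i + s) <# H"
    "\<And>i. near (pos w (i + s) <# H) (7 * K) (pos w (i + s)) (t \<otimes> pos w' i)"
    "\<And>i. near (pos w (i + s) <# H) (7 * K) (pos w (i + s) \<otimes> letter w (i + s)) (t \<otimes> pos w' i \<otimes> letter w' i)"
    using asymptotic_shift[OF ch ch' as as'] by auto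
  show thesis
  proof (rule that)
    fix i
    show "(t \<otimes> pos w' i) <# H = pos w (i + s) <# H" by (rule s)
    define P where "P = pos w (i + s)"
    define P' where "P' = t \<otimes> pos w' i"
    define l where "l = letter w (i + s)"
    define l' where "l' = letter w' i"
    have lA: "l \<in> A" "l' \<in> A" using letter_in_set w w'0 by (auto simp: l_def l'_def)
    then have lc: "l \<in> carrier G" "l' \<in> carrier G" using AH H_carrier by auto
    have Pc: "P \<in> carrier G" "P' \<in> carrier G" using pc t by (auto simp: P_def P'_def)
    have mem: "P \<in> P <# H" "P \<otimes> l \<in> P <# H" "P' \<in> P <# H" "P' \<otimes> l' \<in> P <# H"
      using chainD(2,3)[OF ch, of "i + s"] chainD(2,3)[OF ch', of i] s(1)[of i]
      by (simp_all add: P_def P'_def l_def l'_def)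
    define k where "k = inv P \<otimes> P'"
    define k' where "k' = inv (P \<otimes> l) \<otimes> (P' \<otimes> l')"
    have "k \<in> rel_ball (7 * K)" "k' \<in> rel_ball (7 * K)"
      using s(2,3)[of i] near_coset_iff[OF Pc(1) mem(1,3)] near_coset_iff[OF Pc(1) mem(2,4)]
      by (simp_all add: P_def P'_def l_def l'_def k_def k'_def)
    moreover have "k \<otimes> l' = l \<otimes> k'"
      using Pc lc by (simp add: k_def k'_def inv_mult_group m_assoc cancel_left)
    ultimately show "letter w' i = letter w (i + s)"
      using A lA unfolding separated_def l_def l'_def by metis
  qed
qed

text \<open>For given \<open>c\<close>, \<open>k\<close> and \<open>k'\<close> each of the two
  possible coincidences excludes one \<open>b\<close>. Since \<open>A\<close> and the balls are
  finite, an infinite \<open>H\<close> has room left.\<close>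

lemma separated_extend:
  assumes A: "separated A" "finite A" and "infinite H"
  obtains b where "b \<notin> A" "separated (insert b A)"
proof -
  let ?B = "rel_ball (7 * K)"
  define bad where "bad = A \<union> rel_ball (15 * K) \<union> (\<lambda>(k, b, k'). inv k \<otimes> (b \<otimes> k')) ` (?B \<times> A \<times> ?B)
     \<union> (\<lambda>(k, b, k'). k \<otimes> b \<otimes> inv k') ` (?B \<times> A \<times> ?B)"
  have "finite bad" unfolding bad_def using A finite_rel_ball by auto
  then obtain b where b: "b \<in> H" "b \<notin> bad" using assms(3) by (meson finite_subset subsetI)
  have AH: "A \<subseteq> H" using A by (simp add: separated_def)
  have BH: "?B \<subseteq> H" by (auto simp: rel_ball_def)
  have bc: "b \<in> carrier G" using b H_carrier by blast
  have 1: "k \<otimes> b \<noteq> c \<otimes> k'" if "c \<in> A" "k \<in> ?B" "k' \<in> ?B" for c k k'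
  proof
    assume *: "k \<otimes> b = c \<otimes> k'"
    have "inv k \<otimes> (c \<otimes> k') = b"
      unfolding *[symmetric] using that BH H_carrier bc by (simp add: cancel_left subset_iff)
    then have "b \<in> bad" using that unfolding bad_def by force
    with b show False by blast
  qed
  have 2: "k \<otimes> c \<noteq> b \<otimes> k'" if "c \<in> A" "k \<in> ?B" "k' \<in> ?B" for c k k'
  proof
    assume *: "k \<otimes> c = b \<otimes> k'"
    have "k \<otimes> c \<otimes> inv k' = b"
      unfolding * using that BH H_carrier bc by (simp add: m_assoc subset_iff)
    then have "b \<in> bad" using that unfolding bad_def by force
    with b show False by blast
  qed
  have "separated (insert b A)"
    using A b 1 2 unfolding separated_def bad_def by auto
  moreover have "b \<notin> A" using b by (simp add: bad_def)
  ultimately show thesis using that by blast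
qed

lemma three_separated:
  assumes "infinite H"
  obtains b0 b1 b2 where "separated {b0, b1, b2}" "b1 \<noteq> b2" "b0 \<noteq> b1" "b0 \<noteq> b2"
proof -
  have "separated {}" by (simp add: separated_def)
  then obtain b2 where b2: "separated {b2}" using separated_extend[OF _ _ assms] by blast
  then obtain b1 where b1: "b1 \<notin> {b2}" "separated {b1, b2}" using separated_extend[OF _ _ assms] by blast
  then obtain b0 where b0: "b0 \<notin> {b1, b2}" "separated {b0, b1, b2}"
    using separated_extend[OF _ _ assms, of "{b1, b2}"] by auto
  show thesis using that[of b0 b1 b2] b0 b1 by blast
qed

section \<open>Words with a single marker letter\<close>

lemma letter_marker:
  assumes "b0 \<notin> set u"
  shows "letter (b0 # u) i = b0 \<longleftrightarrow> i mod int (Suc (length u)) = 0"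
proof -
  define r where "r = i mod int (Suc (length u))"
  have r: "0 \<le> r" "r < int (Suc (length u))" by (simp_all add: r_def)
  have "(b0 # u) ! nat r = b0 \<longleftrightarrow> r = 0"
  proof
    assume *: "(b0 # u) ! nat r = b0"
    show "r = 0"
    proof (rule ccontr)
      assume "r \<noteq> 0"
      then have "(b0 # u) ! nat r \<in> set u" using r by (simp add: nth_Cons')
      with * assms show False by simp
    qed
  qed simp
  then show ?thesis by (simp add: letter_def r_def)
qed

text \<open>The marker at index 0 of one path must face a marker at index \<open>s\<close> of the
  other. Markers occur only at multiples of the period, so the shift is by whole periods and all
  letters agree.\<close>

lemma marked_word_conjugate:
  assumes A: "separated A" and u: "set u \<subseteq> A - {b0}" "set u' \<subseteq> A - {b0}" "b0 \<in> A"
    "length u' = length u"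
    and t: "t \<in> carrier G" "t \<otimes> word_prod (b0 # u') = word_prod (b0 # u) \<otimes> t"
  obtains k where "\<And>i. (t \<otimes> pos (b0 # u') i) <# H = pos (b0 # u) (i + k * int (Suc (length u))) <# H"
    "u' = u"
proof -
  obtain s where s: "\<And>i. (t \<otimes> pos (b0 # u') i) <# H = pos (b0 # u) (i + s) <# H"
    "\<And>i. letter (b0 # u') i = letter (b0 # u) (i + s)"
    using separated_conjugate_shift[OF A, of "b0 # u" "b0 # u'" t] u t by auto
  have "letter (b0 # u') 0 = b0" by (simp add: letter_def)
  then have "s mod int (Suc (length u)) = 0"
    using s(2)[of 0] letter_marker[of b0 u s] u by auto
  then obtain k where k: "s = k * int (Suc (length u))" by (metis mod_0_imp_dvd dvd_def mult.commute)
  have "u' = u"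
  proof (rule nth_equalityI)
    fix i assume i: "i < length u'"
    have "letter (b0 # u') (int (Suc i)) = letter (b0 # u) (int (Suc i))"
      using s(2)[of "int (Suc i)"] by (simp add: letter_def k)
    then show "u' ! i = u ! i"
      using i u(4) by (simp add: letter_def nat_add_distrib)
  qed (rule u)
  then show thesis using that s(1) k by blast
qed

text \<open>A root \<open>t\<close> commutes with \<open>g\<close>, so
  \<open>marked_word_conjugate\<close> with \<open>u' = u\<close> shows that \<open>t\<close> moves
  the cosets by \<open>k * N\<close>. Its power \<open>t [^] n\<close> moves them by
  \<open>n * k * N\<close>, but equals \<open>g\<close>, which moves them by
  \<open>N\<close>.\<close>

lemma marked_word_not_proper_power:
  assumes A: "separated A" and u: "set u \<subseteq> A - {b0}" "b0 \<in> A"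
  shows "not_proper_power G (word_prod (b0 # u))"
  unfolding not_proper_power_def
proof (intro ballI allI impI)
  fix t and n :: int
  assume t: "t \<in> carrier G" and tn: "t [^] n = word_prod (b0 # u)"
  define g where "g = word_prod (b0 # u)"
  define N where "N = int (Suc (length u))"
  define Y where "Y i = pos (b0 # u) i <# H" for i
  have wH: "set (b0 # u) \<subseteq> H" using A u by (auto simp: separated_def)
  have far: "set (b0 # u) \<inter> rel_ball (15 * K) = {}" using A u by (auto simp: separated_def)
  have pc: "pos (b0 # u) i \<in> carrier G" for i using pos_carrier[OF wH] .
  have ch: "chain Y (pos (b0 # u)) (\<lambda>i. pos (b0 # u) i \<otimes> letter (b0 # u) i)"
    using word_chain[OF wH _ far one_closed] pc by (simp add: Y_def[abs_def])
  have "t \<otimes> g = g \<otimes> t"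
    unfolding g_def tn[symmetric] using t int_pow_mult[of t 1 n] int_pow_mult[of t n 1]
    by (simp add: add.commute)
  then obtain k where k: "\<And>i. (t \<otimes> pos (b0 # u) i) <# H = Y (i + k * N)"
    using marked_word_conjugate[OF A u(1) u(1) u(2) refl t] unfolding g_def N_def Y_def by blast
  have step: "t \<otimes> x \<in> Y (i + k * N) \<longleftrightarrow> x \<in> Y i" if "x \<in> carrier G" for x i
    using coset_translate[OF t pc that, of i] unfolding k by (simp add: Y_def)
  \<comment> \<open>The induction runs in both directions, as the exponent may be negative.\<close>
  have "t [^] m \<otimes> x \<in> Y (i + m * (k * N)) \<longleftrightarrow> x \<in> Y i" if "x \<in> carrier G" for x i and m :: int
  proof (induction m rule: int_induct[where k = 0])
    case base
    then show ?case using that by simp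
  next
    case (step1 m)
    have "t [^] (m + 1) \<otimes> x = t \<otimes> (t [^] m \<otimes> x)"
      using t that int_pow_mult[OF t, of 1 m] by (simp add: m_assoc add.commute)
    then show ?case
      using step[of "t [^] m \<otimes> x" "i + m * (k * N)"] step1 t that by (simp add: algebra_simps)
  next
    case (step2 m)
    have "t \<otimes> (t [^] (m - 1) \<otimes> x) = t [^] m \<otimes> x"
      using t that int_pow_mult[OF t, of 1 "m - 1"] by (simp add: m_assoc)
    then show ?case
      using step[of "t [^] (m - 1) \<otimes> x" "i + (m - 1) * (k * N)"] step2 t that by (simp add: algebra_simps)
  qed
  from this[of "pos (b0 # u) 0" n 0] have "g \<otimes> pos (b0 # u) 0 \<in> Y (n * (k * N))"
    using chainD(2)[OF ch] pc by (simp add: tn g_def)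
  moreover have "g \<otimes> pos (b0 # u) 0 = pos (b0 # u) N"
    using pos_period[OF wH, of 0 1] word_prod_carrier[OF wH] by (simp add: g_def N_def)
  ultimately have "pos (b0 # u) N \<in> Y N \<inter> Y (n * (k * N))" using chainD(2)[OF ch] by simp
  then have "Y N = Y (n * (k * N))"
    using clique_disjoint[OF chainD(1)[OF ch] chainD(1)[OF ch], of N "n * (k * N)"] by auto
  then have "N = n * (k * N)" by (rule injD[OF chain_inj[OF ch]])
  then have "n * k = 1" by (simp add: N_def)
  then show "n = 1 \<or> n = -1" using zmult_eq_1_iff by blast
qed

end


section \<open>Counting conjugacy classes\<close>

context group
begin

section \<open>Word length and the size of balls\<close>

lemma foldr_mult_closed: "set w \<subseteq> carrier G \<Longrightarrow> foldr (\<otimes>) w \<one> \<in> carrier G"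
  by (induction w) auto

lemma foldr_mult_append:
  assumes "set v \<subseteq> carrier G" "set w \<subseteq> carrier G"
  shows "foldr (\<otimes>) (v @ w) \<one> = foldr (\<otimes>) v \<one> \<otimes> foldr (\<otimes>) w \<one>"
  using assms(1) by (induction v) (auto simp: m_assoc foldr_mult_closed assms(2))

lemma set_inv_carrier: "S \<subseteq> carrier G \<Longrightarrow> S \<union> set_inv S \<subseteq> carrier G"
  by (auto simp: SET_INV_def)

lemma generate_imp_word:
  assumes "g \<in> generate G S" "S \<subseteq> carrier G"
  shows "\<exists>w. set w \<subseteq> S \<union> set_inv S \<and> foldr (\<otimes>) w \<one> = g"
  using assms(1)
proof (induction rule: generate.induct)
  case one
  then show ?case by (intro exI[of _ "[]"]) simp
next
  case (incl h)
  then show ?case using assms by (intro exI[of _ "[h]"]) auto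
next
  case (inv h)
  then show ?case using assms by (intro exI[of _ "[inv h]"]) (auto simp: SET_INV_def)
next
  case (eng h1 h2)
  then obtain w1 w2 where w: "set w1 \<subseteq> S \<union> set_inv S" "foldr (\<otimes>) w1 \<one> = h1"
    "set w2 \<subseteq> S \<union> set_inv S" "foldr (\<otimes>) w2 \<one> = h2" by blast
  then have "foldr (\<otimes>) (w1 @ w2) \<one> = h1 \<otimes> h2"
    using foldr_mult_append[of w1 w2] set_inv_carrier[OF assms(2)] by blast
  with w show ?case by (intro exI[of _ "w1 @ w2"]) auto
qed

lemma word_length_le:
  assumes "set w \<subseteq> S \<union> set_inv S" "foldr (\<otimes>) w \<one> = g"
  shows "word_length G S g \<le> length w"
  unfolding word_length_def using assms by (intro Least_le) blast

lemma word_length_word: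
  assumes "S \<subseteq> carrier G" "generate G S = carrier G" "g \<in> carrier G"
  obtains w where "length w = word_length G S g" "set w \<subseteq> S \<union> set_inv S" "foldr (\<otimes>) w \<one> = g"
proof -
  have "\<exists>n w. length w = n \<and> set w \<subseteq> S \<union> set_inv S \<and> foldr (\<otimes>) w \<one> = g"
    using generate_imp_word[of g S] assms by auto
  from LeastI_ex[OF this] show thesis unfolding word_length_def[symmetric] using that by blast
qed

lemma word_length_mult:
  assumes "S \<subseteq> carrier G" "generate G S = carrier G" "g \<in> carrier G" "h \<in> carrier G"
  shows "word_length G S (g \<otimes> h) \<le> word_length G S g + word_length G S h"
proof -
  obtain v where v: "length v = word_length G S g" "set v \<subseteq> S \<union> set_inv S" "foldr (\<otimes>) v \<one> = g"
    using word_length_word[OF assms(1,2,3)] .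
  obtain w where w: "length w = word_length G S h" "set w \<subseteq> S \<union> set_inv S" "foldr (\<otimes>) w \<one> = h"
    using word_length_word[OF assms(1,2,4)] .
  have "foldr (\<otimes>) (v @ w) \<one> = g \<otimes> h"
    using foldr_mult_append[of v w] v w set_inv_carrier[OF assms(1)] by blast
  then show ?thesis using word_length_le[of "v @ w" S "g \<otimes> h"] v w by simp
qed

lemma word_ball_exponential:
  assumes "finite S" "S \<subseteq> carrier G" "generate G S = carrier G"
  obtains C where "C \<ge> 1" "\<And>n. finite (word_ball G S n)" "\<And>n. card (word_ball G S n) \<le> 2 ^ (C * n)"
proof -
  \<comment> \<open>The identity is included so that words can be padded to length exactly
    \<open>n\<close>; it also ensures \<open>card T \<ge> 1\<close>.\<close>
  define T where "T = insert \<one> (S \<union> set_inv S)"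
  have fT: "finite T" using assms by (simp add: T_def SET_INV_def)
  have Tc: "T \<subseteq> carrier G" using set_inv_carrier[OF assms(2)] by (simp add: T_def)
  define W where "W n = {w. set w \<subseteq> T \<and> length w = n}" for n
  have sub: "word_ball G S n \<subseteq> (\<lambda>w. foldr (\<otimes>) w \<one>) ` W n" for n
  proof
    fix g assume "g \<in> word_ball G S n"
    then have g: "g \<in> carrier G" "word_length G S g \<le> n" by (auto simp: word_ball_def)
    obtain w where w: "length w = word_length G S g" "set w \<subseteq> S \<union> set_inv S" "foldr (\<otimes>) w \<one> = g"
      using word_length_word[OF assms(2,3) g(1)] .
    define v where "v = replicate (n - length w) \<one>"
    have "foldr (\<otimes>) (replicate m \<one>) \<one> = \<one>" for m by (induction m) auto
    then have "foldr (\<otimes>) (w @ v) \<one> = g"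
      using foldr_mult_append[of w v] w Tc g(1) by (auto simp: v_def T_def)
    moreover have "w @ v \<in> W n" using w g by (auto simp: W_def T_def v_def)
    ultimately show "g \<in> (\<lambda>w. foldr (\<otimes>) w \<one>) ` W n" by force
  qed
  have W: "finite (W n)" "card (W n) = card T ^ n" for n
    using finite_lists_length_eq[OF fT] card_lists_length_eq[OF fT] by (simp_all add: W_def)
  show thesis
  proof (rule that)
    show "card T \<ge> 1" using fT by (simp add: T_def Suc_le_eq card_gt_0_iff)
    show "finite (word_ball G S n)" for n using sub W(1) finite_subset by blast
    show "card (word_ball G S n) \<le> 2 ^ (card T * n)" for n
    proof -
      have "card (word_ball G S n) \<le> card T ^ n" using surj_card_le[OF W(1) sub] W(2) by simp
      also have "\<dots> \<le> (2 ^ card T) ^ n" by (simp add: power_mono less_imp_le)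
      finally show ?thesis by (simp add: power_mult)
    qed
  qed
qed

section \<open>Conjugacy classes as orbits\<close>

definition conj_class :: "'a \<Rightarrow> 'a set" where
  "conj_class x = orbit G (\<lambda>g. \<lambda>h\<in>carrier G. g \<otimes> h \<otimes> inv g) x"

lemma conj_class_conjugacy: "x \<in> carrier G \<Longrightarrow> conj_class x \<in> conjugacy_classes G"
  by (auto simp: conj_class_def conjugacy_classes_def orbits_def)

lemma mem_conj_class: "x \<in> carrier G \<Longrightarrow> x \<in> conj_class x"
  unfolding conj_class_def by (rule group_action.orbit_refl[OF action_by_conjugation])

lemma conj_class_conjugate:
  assumes "y \<in> conj_class x" "x \<in> carrier G"
  obtains t where "t \<in> carrier G" "t \<otimes> x = y \<otimes> t"
proof -
  obtain t where t: "t \<in> carrier G" "y = t \<otimes> x \<otimes> inv t"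
    using assms by (auto simp: conj_class_def orbit_def)
  then have "y \<otimes> t = t \<otimes> x" using assms by (simp add: m_assoc)
  with t that show thesis by metis
qed

text \<open>Choosing a point of \<open>B\<close> in each class is injective, because distinct
  classes are disjoint.\<close>

lemma conjugacy_classes_meeting:
  assumes "finite B"
  shows "finite {c \<in> conjugacy_classes G. c \<inter> B \<noteq> {}}" "card {c \<in> conjugacy_classes G. c \<inter> B \<noteq> {}} \<le> card B"
proof -
  let ?C = "{c \<in> conjugacy_classes G. c \<inter> B \<noteq> {}}"
  define f where "f c = (SOME x. x \<in> c \<inter> B)" for c
  have f: "f c \<in> c \<inter> B" if "c \<in> ?C" for c
    unfolding f_def by (rule someI_ex) (use that in blast)
  have inj: "inj_on f ?C"
  proof (rule inj_onI)
    fix c c' assume c: "c \<in> ?C" "c' \<in> ?C" "f c = f c'"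
    then have "c \<inter> c' \<noteq> {}" using f[OF c(1)] f[OF c(2)] by auto
    then show "c = c'"
      using group_action.disjoint_union[OF action_by_conjugation, of c c'] c
      by (auto simp: conjugacy_classes_def)
  qed
  have im: "f ` ?C \<subseteq> B" using f by blast
  show "finite ?C" by (rule inj_on_finite[OF inj im assms])
  show "card ?C \<le> card B" by (rule card_inj_on_le[OF inj im assms])
qed

end

text \<open>Marked words over \<open>b1\<close> and \<open>b2\<close> supply the primitive classes.
  Their word length grows linearly, since each block \<open>b \<otimes> a\<close> costs at most
  \<open>M\<close> generators.\<close>

lemma (in hyp_embedded_pair) prim_conj_growth_exponential:
  assumes S: "finite S" "S \<subseteq> carrier G" "generate G S = carrier G" and "infinite H"
  shows "growth_le (\<lambda>n. 2 ^ n) (prim_conj_growth G S)"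
proof -
  obtain b0 b1 b2 where sep: "separated {b0, b1, b2}" and ne: "b1 \<noteq> b2" "b0 \<noteq> b1" "b0 \<noteq> b2"
    using three_separated[OF assms(4)] .
  let ?A = "{b0, b1, b2}"
  have AH: "?A \<subseteq> H" using sep unfolding separated_def by blast
  define M where "M = Max ((\<lambda>b. word_length G S (b \<otimes> a)) ` ?A)"
  have M: "word_length G S (b \<otimes> a) \<le> M" if "b \<in> ?A" for b
    unfolding M_def using that by (intro Max_ge) auto
  have len: "word_length G S (word_prod w) \<le> M * length w" if "set w \<subseteq> ?A" for w
    using that
  proof (induction w)
    case Nil
    then show ?case using word_length_le[of "[]" S \<one>] by simp
  next
    case (Cons b w)
    have "word_length G S (word_prod (b # w)) \<le> word_length G S (b \<otimes> a) + word_length G S (word_prod w)"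
      unfolding word_prod.simps
    proof (rule word_length_mult[OF S(2,3)])
      have "b \<in> H" "set w \<subseteq> H" using Cons.prems AH by auto
      then show "b \<otimes> a \<in> carrier G" "word_prod w \<in> carrier G"
        using H_carrier word_prod_carrier by auto
    qed
    also have "\<dots> \<le> M + M * length w"
      using Cons M[of b] by (intro add_mono) auto
    finally show ?case by simp
  qed
  define U where "U n = {u. set u \<subseteq> {b1, b2} \<and> length u = n}" for n :: nat
  define F where "F u = conj_class (word_prod (b0 # u))" for u
  define P where "P n = {c \<in> conjugacy_classes G. primitive_class G c \<and> c \<inter> word_ball G S n \<noteq> {}}" for n
  obtain C where fin: "\<And>n. finite (word_ball G S n)" using word_ball_exponential[OF S] by blast
  \<comment> \<open>\<open>card\<close> is 0 on infinite sets, so comparing the counts requires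
    finiteness.\<close>
  have finP: "finite (P n)" for n
    by (rule finite_subset[OF _ conjugacy_classes_meeting(1)[OF fin]]) (auto simp: P_def)
  have carr: "word_prod (b0 # u) \<in> carrier G" if "u \<in> U n" for u n
    by (rule word_prod_carrier) (use that AH in \<open>auto simp: U_def\<close>)
  have inj: "inj_on F (U n)" for n
  proof (rule inj_onI)
    fix u u' assume u: "u \<in> U n" "u' \<in> U n" "F u = F u'"
    have "word_prod (b0 # u) \<in> conj_class (word_prod (b0 # u'))"
      using u mem_conj_class[OF carr[OF u(1)]] by (simp add: F_def)
    then obtain t where t: "t \<in> carrier G" "t \<otimes> word_prod (b0 # u') = word_prod (b0 # u) \<otimes> t"
      using conj_class_conjugate carr[OF u(2)] by blast
    have "set u \<subseteq> ?A - {b0}" "set u' \<subseteq> ?A - {b0}" "length u' = length u"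
      using u ne by (auto simp: U_def)
    then show "u = u'" using marked_word_conjugate[OF sep _ _ _ _ t] by blast
  qed
  have FP: "F ` U n \<subseteq> P (M * Suc n)" for n
  proof (rule image_subsetI)
    fix u assume u: "u \<in> U n"
    have "not_proper_power G (word_prod (b0 # u))"
      by (rule marked_word_not_proper_power[OF sep]) (use u ne in \<open>auto simp: U_def\<close>)
    moreover have "word_prod (b0 # u) \<in> word_ball G S (M * Suc n)"
      using carr[OF u] len[of "b0 # u"] u by (auto simp: word_ball_def U_def)
    ultimately show "F u \<in> P (M * Suc n)"
      using conj_class_conjugacy[OF carr[OF u]] mem_conj_class[OF carr[OF u]]
      unfolding P_def F_def primitive_class_def by blast
  qed
  \<comment> \<open>A marked word has \<open>n + 1\<close> blocks, and
    \<open>M * (n + 1) \<le> 2 * M * n\<close> for \<open>n \<ge> 1\<close>. The summand 1 keeps the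
    constant positive when \<open>M = 0\<close>.\<close>
  have "2 ^ n \<le> prim_conj_growth G S ((2 * M + 1) * n)" if "n \<ge> 1" for n
  proof -
    have "card (U n) = 2 ^ n"
      using card_lists_length_eq[of "{b1, b2}" n] ne by (simp add: U_def numeral_2_eq_2)
    then have card_U: "2 ^ n \<le> card (P (M * Suc n))"
      using card_inj_on_le[OF inj FP finP] by metis
    have "M \<le> M * n" using that by simp
    then have "M * Suc n \<le> (2 * M + 1) * n"
      unfolding mult_Suc_right distrib_right mult_2 by linarith
    then have "P (M * Suc n) \<subseteq> P ((2 * M + 1) * n)"
      unfolding P_def word_ball_def by fastforce
    then have "card (P (M * Suc n)) \<le> card (P ((2 * M + 1) * n))" by (rule card_mono[OF finP])
    with card_U show ?thesis by (simp add: prim_conj_growth_def P_def)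
  qed
  then show ?thesis unfolding growth_le_def by (intro exI[of _ "2 * M + 1"]) auto
qed

theorem theorem1p1:
  fixes G :: "('a, 'b) monoid_scheme" and S :: "'a set"
  assumes "group G"
    and "finite S" and "S \<subseteq> carrier G" and "generate G S = carrier G"
    and "\<exists>H. nondegenerate_hyp_embedded G H"
  shows "growth_equiv (conj_growth G S) (prim_conj_growth G S) \<and>
         growth_equiv (prim_conj_growth G S) (\<lambda>n. 2 ^ n)"
proof -
  interpret group G by (rule assms(1))
  obtain H X where HX: "hyp_embedded_wrt G H X" and H: "infinite H" "H \<noteq> carrier G"
    using assms(5) unfolding nondegenerate_hyp_embedded_def hyp_embedded_def by blast
  have sub: "subgroup H G" and gen: "generate G (X \<union> H) = carrier G"
    using HX by (auto simp: hyp_embedded_wrt_def)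
  \<comment> \<open>If \<open>X\<close> were inside \<open>H\<close>, then \<open>H\<close> would be
    the whole group; an element of \<open>X\<close> outside \<open>H\<close> supplies the letter
    \<open>a\<close>.\<close>
  have "\<not> X \<subseteq> H"
  proof
    assume "X \<subseteq> H"
    then have "generate G (X \<union> H) \<subseteq> H" using generate_subgroup_incl[OF _ sub] by blast
    then show False using gen H(2) subgroup.subset[OF sub] by blast
  qed
  then obtain a where a: "a \<in> X" "a \<notin> H" by blast
  have "gromov_hyperbolic (carrier G) (\<lambda>u v. real (cayley_dist G (X \<union> H) u v))"
    using HX by (simp add: hyp_embedded_wrt_def hyperbolic_graph_def cayley_dist_def)
  then obtain \<Delta> where "hyp_embedded_pair G H X a \<Delta>"
    using gromov_hyperbolic_four_point
    by (metis HX a group_axioms hyp_embedded_pair.intro hyp_embedded_pair_axioms.intro)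
  then have lower: "growth_le (\<lambda>n. 2 ^ n) (prim_conj_growth G S)"
    by (rule hyp_embedded_pair.prim_conj_growth_exponential[OF _ assms(2-4) H(1)])
  obtain C where C: "C \<ge> 1" "\<And>n. finite (word_ball G S n)" "\<And>n. card (word_ball G S n) \<le> 2 ^ (C * n)"
    using word_ball_exponential[OF assms(2-4)] by blast
  have prim_le: "prim_conj_growth G S n \<le> conj_growth G S n" for n
    unfolding prim_conj_growth_def conj_growth_def
    by (intro card_mono conjugacy_classes_meeting(1)[OF C(2)]) blast
  have conj_le: "conj_growth G S n \<le> 2 ^ (C * n)" for n
    unfolding conj_growth_def using conjugacy_classes_meeting(2)[OF C(2)] C(3) le_trans by blast
  obtain D where D: "D \<ge> 1" "\<And>n. n \<ge> 1 \<Longrightarrow> 2 ^ n \<le> prim_conj_growth G S (D * n)"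
    using lower unfolding growth_le_def by blast
  \<comment> \<open>The upper bound \<open>2 ^ (C * n)\<close> on all classes is fed into the lower
    bound on primitive classes at \<open>C * n\<close>.\<close>
  have "conj_growth G S n \<le> prim_conj_growth G S (D * C * n)" if "n \<ge> 1" for n
  proof -
    have "1 \<le> C * n" using C(1) that by simp
    from le_trans[OF conj_le D(2)[OF this]] show ?thesis by (simp add: mult.assoc)
  qed
  moreover have "1 \<le> D * C" using C(1) D(1) by simp
  ultimately have "growth_le (conj_growth G S) (prim_conj_growth G S)"
    unfolding growth_le_def by blast
  moreover have "growth_le (prim_conj_growth G S) (conj_growth G S)"
    unfolding growth_le_def using prim_le by (intro exI[of _ 1]) auto
  moreover have "growth_le (prim_conj_growth G S) (\<lambda>n. 2 ^ n)"
    unfolding growth_le_def using C(1) le_trans[OF prim_le conj_le] by blast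
  ultimately show ?thesis using lower unfolding growth_equiv_def by blast
qed

end
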